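(* Let $c$ be a real number, and let $b_c(x)=|\{q\in T(c)\colon q\leq x\}|$. Then $\displaystyle\lim_{x\to\infty}\frac{b_c(x)}{\pi(x)}=1$, where $\pi(x)$ is the number of primes at most $x$.
   Context: Let $\overline{\psi}$ be the multiplicative arithmetic function with $\overline{\psi}(p^{\alpha})=p^{\alpha-1}(p+1)$ for odd primes $p$ and $\overline{\psi}(2^{\alpha})=2^{\alpha-1}$, for all positive integers $\alpha$ (so $\overline{\psi}(1)=1$). For $n>1$, $\lambda(n)$ is the unique nonnegative integer with $\overline{\psi}^{\lambda(n)}(n)=2$ (where $\overline{\psi}^k$ is the $k$-th iterate, $\overline{\psi}^0(n)=n$), and $\lambda(1)=0$. For an odd prime $p$, $\eta(p)=\lambda(p)-\log_2(p)$. For a real number $c$, $T(c)$ is the set of odd primes $q$ with $\eta(q)>c+1$. *)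

theory Defs
  imports Complex_Main "HOL-Computational_Algebra.Primes"
begin

definition psibar :: "nat \<Rightarrow> nat" where
  "psibar n = (\<Prod>p\<in>prime_factors n.
     if p = 2 then 2 ^ (multiplicity p n - 1)
     else p ^ (multiplicity p n - 1) * (p + 1))"

text \<open>
  The next three lemmas characterise \<open>psibar\<close> as the multiplicative function with the
  intended values at prime powers.
\<close>

lemma psibar_prime_power_odd:
  assumes "prime p" "odd p" "a > 0"
  shows "psibar (p ^ a) = p ^ (a - 1) * (p + 1)"
proof -
  have "p \<noteq> 2" using assms by auto
  then show ?thesis using assms
    by (simp add: psibar_def prime_factorization_prime_power)
qed

lemma psibar_two_power: "a > 0 \<Longrightarrow> psibar (2 ^ a) = 2 ^ (a - 1)"
  by (simp add: psibar_def prime_factorization_prime_power)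

lemma psibar_mult:
  assumes "coprime m n" "m > 0" "n > 0"
  shows "psibar (m * n) = psibar m * psibar n"
proof -
  let ?g = "\<lambda>n p. if p = 2 then 2 ^ (multiplicity p n - 1)
     else p ^ (multiplicity p n - 1) * (p + 1) :: nat"
  have disj: "prime_factors m \<inter> prime_factors n = {}"
  proof -
    have False if "p \<in> prime_factors m" "p \<in> prime_factors n" for p
    proof -
      have "prime p" "p dvd m" "p dvd n" using that by auto
      then show False using assms(1) coprime_common_divisor not_prime_unit by blast
    qed
    then show ?thesis by blast
  qed
  have 1: "multiplicity p (m * n) = multiplicity p m" if "p \<in> prime_factors m" for p
  proof -
    have "multiplicity p n = 0" using that disj by (auto simp: prime_factors_multiplicity)
    then show ?thesis using that assms
      by (simp add: prime_elem_multiplicity_mult_distrib in_prime_factors_iff)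
  qed
  have 2: "multiplicity p (m * n) = multiplicity p n" if "p \<in> prime_factors n" for p
  proof -
    have "multiplicity p m = 0" using that disj by (auto simp: prime_factors_multiplicity)
    then show ?thesis using that assms
      by (simp add: prime_elem_multiplicity_mult_distrib in_prime_factors_iff)
  qed
  have "psibar (m * n) = prod (?g (m * n)) (prime_factors m \<union> prime_factors n)"
    using assms by (simp add: psibar_def prime_factors_product)
  also have "\<dots> = prod (?g (m * n)) (prime_factors m) * prod (?g (m * n)) (prime_factors n)"
    using disj by (simp add: prod.union_disjoint)
  also have "prod (?g (m * n)) (prime_factors m) = psibar m"
    unfolding psibar_def using 1 by (intro prod.cong) auto
  also have "prod (?g (m * n)) (prime_factors n) = psibar n"
    unfolding psibar_def using 2 by (intro prod.cong) auto
  finally show ?thesis .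
qed

definition psi_lambda :: "nat \<Rightarrow> nat" where
  "psi_lambda n = (if n > 1 then THE k. (psibar ^^ k) n = 2 else 0)"

text \<open>
  The description above is proper: iteration strictly decreases the multiset of prime factors
  (one copy of each odd prime \<open>p\<close> is traded for the prime factors of \<open>p + 1\<close>,
  all smaller than \<open>p\<close>), hence reaches 1, and 2 is the only number above 1 that is
  mapped to 1.
\<close>

lemma psibar_pos: "psibar n > 0"
  unfolding psibar_def by (intro prod_pos) (auto simp: in_prime_factors_iff prime_gt_0_nat)

lemma psibar_prime_factorization_less:
  assumes "n > 1"
  shows "(prime_factorization (psibar n), prime_factorization n) \<in> mult less_than"
proof -
  define J where "J = mset_set (prime_factors n)"
  define K where "K = (\<Sum>p\<in>prime_factors n. if p = 2 then {#} else prime_factorization (p + 1))"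
  define I where "I = prime_factorization n - J"
  have sub: "J \<subseteq># prime_factorization n"
    unfolding J_def by (simp add: mset_set_set_mset_msubset)
  have pf: "prime_factorization (psibar n) =
    (\<Sum>p\<in>prime_factors n. replicate_mset (multiplicity p n - 1) p) + K"
  proof -
    have "prime_factorization (psibar n) = (\<Sum>p\<in>prime_factors n. prime_factorization
       (if p = 2 then 2 ^ (multiplicity p n - 1) else p ^ (multiplicity p n - 1) * (p + 1)))"
      unfolding psibar_def
      by (rule prime_factorization_prod) (auto simp: in_prime_factors_iff)
    also have "\<dots> = (\<Sum>p\<in>prime_factors n. replicate_mset (multiplicity p n - 1) p +
       (if p = 2 then {#} else prime_factorization (p + 1)))"
    proof (rule sum.cong[OF refl])
      fix p assume "p \<in> prime_factors n"
      then have "prime p" by auto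
      then have "prime_factorization (p ^ a * (p + 1)) =
          replicate_mset a p + prime_factorization (p + 1)" for a
        by (subst prime_factorization_mult) (auto simp: prime_factorization_prime_power)
      with \<open>prime p\<close> show "prime_factorization
       (if p = 2 then 2 ^ (multiplicity p n - 1) else p ^ (multiplicity p n - 1) * (p + 1)) =
       replicate_mset (multiplicity p n - 1) p +
       (if p = 2 then {#} else prime_factorization (p + 1))"
        by (auto simp: prime_factorization_prime_power)
    qed
    finally show ?thesis by (simp add: sum.distrib K_def)
  qed
  have I: "(\<Sum>p\<in>prime_factors n. replicate_mset (multiplicity p n - 1) p) = I"
  proof (rule multiset_eqI)
    fix q
    have "count (\<Sum>p\<in>prime_factors n. replicate_mset (multiplicity p n - 1) p) q =
       (\<Sum>p\<in>prime_factors n. if p = q then multiplicity p n - 1 else 0)"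
      by (auto simp: count_sum intro!: sum.cong)
    also have "\<dots> = (if q \<in> prime_factors n then multiplicity q n - 1 else 0)"
      by (simp add: sum.delta)
    also have "\<dots> = count I q"
    proof (cases "q \<in> prime_factors n")
      case True
      then show ?thesis
        by (simp add: I_def J_def count_mset_set' count_prime_factorization_prime
            in_prime_factors_iff)
    next
      case False
      then show ?thesis by (simp only: I_def count_diff not_in_iff if_not_P diff_0_eq_0 not_False_eq_True)
    qed
    finally show "count (\<Sum>p\<in>prime_factors n. replicate_mset (multiplicity p n - 1) p) q = count I q" .
  qed
  have K: "\<exists>j\<in>set_mset J. (k, j) \<in> less_than" if "k \<in># K" for k
  proof -
    from that obtain p where p: "p \<in> prime_factors n" "p \<noteq> 2" "k \<in> prime_factors (p + 1)"
      unfolding K_def by (auto simp: set_mset_sum split: if_splits)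
    from p have pp: "prime p" and kp: "prime k" "k dvd p + 1" by auto
    have "odd p" using pp p(2) primes_dvd_imp_eq two_is_prime_nat by blast
    have "k \<le> p + 1" using kp by (auto dest: dvd_imp_le)
    moreover have "k \<noteq> p + 1"
    proof
      assume "k = p + 1"
      then have "even k" using \<open>odd p\<close> by simp
      then have "k = 2" using kp(1) primes_dvd_imp_eq two_is_prime_nat by blast
      then show False using \<open>k = p + 1\<close> prime_gt_1_nat[OF pp] by simp
    qed
    moreover have "k \<noteq> p"
    proof
      assume "k = p"
      then have "p dvd 1" using kp(2) dvd_add_right_iff[of p p 1] by simp
      then show False using pp by auto
    qed
    ultimately have "k < p" by linarith
    with p(1) show ?thesis by (auto simp: J_def)
  qed
  have "J \<noteq> {#}" using assms
    by (auto simp: J_def mset_set_empty_iff prime_factorization_empty_iff)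
  then have "(I + K, I + J) \<in> mult less_than"
    using K by (intro one_step_implies_mult) auto
  with pf I sub show ?thesis by (simp add: I_def)
qed

lemma psibar_eq_1_imp: assumes "n > 1" "psibar n = 1" shows "n = 2"
proof -
  have f: "(if p = 2 then 2 ^ (multiplicity p n - 1)
     else p ^ (multiplicity p n - 1) * (p + 1)) = 1" if "p \<in> prime_factors n" for p
    using assms(2) that unfolding psibar_def by (subst (asm) prod_eq_1_iff) blast+
  have two: "p = 2 \<and> multiplicity p n = 1" if "p \<in> prime_factors n" for p
  proof -
    have "multiplicity p n > 0" using that by (simp add: prime_factors_multiplicity)
    moreover have "p = 2"
    proof (rule ccontr)
      assume "p \<noteq> 2"
      with f[OF that] have "p + 1 = 1" by (metis nat_mult_eq_1_iff)
      with that show False by (simp add: in_prime_factors_iff)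
    qed
    moreover have "2 ^ (multiplicity p n - 1) = (1::nat)"
      using f[OF that] \<open>p = 2\<close> by (simp only: refl if_True)
    then have "multiplicity p n - 1 = 0" by simp
    ultimately show ?thesis by linarith
  qed
  have ne: "prime_factors n \<noteq> {}" using assms(1) by (auto simp: prime_factorization_empty_iff)
  with two have pf: "prime_factors n = {2}" by blast
  then have m: "multiplicity 2 n = 1" using two by blast
  have "n = (\<Prod>p\<in>prime_factors n. p ^ multiplicity p n)"
    using assms(1) by (intro prime_factorization_nat) simp
  also have "\<dots> = 2" unfolding pf using m by simp
  finally show ?thesis .
qed

lemma psi_lambda_ex1:
  assumes "n > 1"
  shows "\<exists>!k. (psibar ^^ k) n = 2"
proof -
  have wf: "wf (inv_image (mult less_than) (prime_factorization :: nat \<Rightarrow> nat multiset))"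
    by (intro wf_inv_image wf_mult) simp
  have ex: "n > 1 \<longrightarrow> (\<exists>k. (psibar ^^ k) n = 2)" for n
  proof (induction n rule: wf_induct_rule[OF wf])
    case (1 n)
    show ?case
    proof
      assume n: "n > 1"
      show "\<exists>k. (psibar ^^ k) n = 2"
      proof (cases "n = 2")
        case True
        then have "(psibar ^^ 0) n = 2" by simp
        then show ?thesis by blast
      next
        case False
        then have "psibar n > 1" using psibar_eq_1_imp[OF n] psibar_pos[of n] by linarith
        with 1 psibar_prime_factorization_less[OF n] obtain k where
          "(psibar ^^ k) (psibar n) = 2" by auto
        then have "(psibar ^^ Suc k) n = 2" by (simp add: funpow_swap1)
        then show ?thesis by blast
      qed
    qed
  qed
  have one: "(psibar ^^ k) 1 = 1" for k
    by (induction k) (simp_all add: psibar_def)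
  have two: "psibar 2 = 1" using psibar_two_power[of 1] by simp
  have uniq: "\<not> k < l" if "(psibar ^^ k) n = 2" "(psibar ^^ l) n = 2" for k l
  proof
    assume "k < l"
    then obtain d where "l = d + Suc k" using less_natE by (metis add.commute add_Suc)
    then have "(psibar ^^ l) n = (psibar ^^ d) (psibar ((psibar ^^ k) n))"
      by (simp add: funpow_add funpow_swap1)
    then show False using that two one[of d] by simp
  qed
  from ex assms obtain k where "(psibar ^^ k) n = 2" by blast
  moreover have "l = k" if "(psibar ^^ l) n = 2" for l
    using uniq[OF calculation that] uniq[OF that calculation] by linarith
  ultimately show ?thesis by blast
qed

definition psi_eta :: "nat \<Rightarrow> real" where
  "psi_eta p = real (psi_lambda p) - log 2 (real p)"

definition psi_T :: "real \<Rightarrow> nat set" where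
  "psi_T c = {q. prime q \<and> odd q \<and> psi_eta q > c + 1}"

definition psi_b :: "real \<Rightarrow> real \<Rightarrow> nat" where
  "psi_b c x = card {q \<in> psi_T c. real q \<le> x}"

definition prime_pi :: "real \<Rightarrow> nat" where
  "prime_pi x = card {p :: nat. prime p \<and> real p \<le> x}"

end

theory Submission
  imports Defs "HOL-Library.FuncSet" "HOL-Library.Disjoint_Sets" "HOL-Real_Asymp.Real_Asymp"
    "HOL-Number_Theory.Cong"
begin

text \<open>
  The function \<open>\<lambda>\<close> dominates (up to 1 at even numbers) every completely additive \<open>F\<close> with \<open>F 2 = 1\<close>
  and \<open>F p \<le> F (p + 1)\<close> at odd primes. Adding to \<open>log\<^sub>2\<close> a fixed gain at the prime 3 and at the
  primes congruent to 5 modulo 6 preserves these conditions, since \<open>p + 1\<close> is then a multiple of 3. Hence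
  \<open>\<eta>(q)\<close> is large as soon as \<open>q + 1\<close> has many prime factors congruent to 5 modulo 6. The
  reciprocals of these primes have a divergent sum, so there are disjoint finite sets \<open>F\<close> of
  them with \<open>\<Prod>p\<in>F. (p - 2) / (p - 1)\<close> as small as desired. If \<open>q + 1\<close> is coprime to all of \<open>F\<close>,
  then \<open>q\<close> lies in one of at most \<open>\<Prod>p\<in>F. (p - 2)\<close> classes modulo \<open>\<Prod>F\<close>, and Selberg's sieve
  bounds the number of primes in each class with a constant independent of the modulus. Chebyshev's
  lower bound for \<open>\<pi>\<close> turns this into a small proportion of all primes.
\<close>

section \<open>Lower bounds for the iteration count\<close>

lemma funpow_psi_lambda: "n > 1 \<Longrightarrow> (psibar ^^ psi_lambda n) n = 2"
  using theI'[OF psi_lambda_ex1, of n] by (simp add: psi_lambda_def)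

lemma psi_lambda_eqI: "n > 1 \<Longrightarrow> (psibar ^^ k) n = 2 \<Longrightarrow> psi_lambda n = k"
  using psi_lambda_ex1[of n] funpow_psi_lambda[of n] by blast

lemma psibar_gt_1: "n > 2 \<Longrightarrow> psibar n > 1"
  using psibar_eq_1_imp[of n] psibar_pos[of n] by linarith

lemma psi_lambda_step:
  assumes "n > 2"
  shows "psi_lambda n = Suc (psi_lambda (psibar n))"
  using assms funpow_psi_lambda[OF psibar_gt_1[OF assms]]
  by (intro psi_lambda_eqI) (auto simp: funpow_swap1)

section \<open>Completely additive lower bounds for \<open>psi_lambda\<close>\<close>

locale additive_weight =
  fixes F :: "nat \<Rightarrow> real"
  assumes mult: "m > 0 \<Longrightarrow> n > 0 \<Longrightarrow> F (m * n) = F m + F n"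
    and two: "F 2 = 1"
    and odd_prime: "prime p \<Longrightarrow> odd p \<Longrightarrow> F p \<le> F (p + 1)"
begin

lemma one: "F 1 = 0"
  using mult[of 1 1] by simp

lemma power: "a > 0 \<Longrightarrow> F (a ^ k) = k * F a"
  by (induction k) (auto simp: one[simplified] mult algebra_simps)

lemma prod: "finite A \<Longrightarrow> (\<And>a. a \<in> A \<Longrightarrow> f a > 0) \<Longrightarrow> F (\<Prod>a\<in>A. f a) = (\<Sum>a\<in>A. F (f a))"
  by (induction A rule: finite_induct) (auto simp: one[simplified] mult prod_pos)

text \<open>\<open>psibar\<close> trades one copy of each odd prime \<open>p\<close> dividing
  \<open>n\<close> for \<open>p + 1\<close>, which cannot lower \<open>F\<close>, and removes one
  factor 2 from an even \<open>n\<close>, which costs \<open>F 2 = 1\<close>.\<close>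

lemma psibar_ge:
  assumes "n > 0"
  shows "F n - of_bool (even n) \<le> F (psibar n)"
proof -
  have "F n = F (\<Prod>p\<in>prime_factors n. p ^ multiplicity p n)"
    using prime_factorization_nat[OF assms] by simp
  also have "\<dots> = (\<Sum>p\<in>prime_factors n. multiplicity p n * F p)"
    by (subst prod) (auto simp: power in_prime_factors_iff prime_gt_0_nat intro!: sum.cong)
  finally have Fn: "F n = (\<Sum>p\<in>prime_factors n. multiplicity p n * F p)" .
  have "of_bool (even n) = (\<Sum>p\<in>prime_factors n. if p = 2 then 1 else (0::real))"
    using assms by (auto simp: sum.delta in_prime_factors_iff)
  then have "F n - of_bool (even n) =
      (\<Sum>p\<in>prime_factors n. multiplicity p n * F p - (if p = 2 then 1 else 0))"
    by (simp add: Fn sum_subtractf)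
  also have "\<dots> \<le> (\<Sum>p\<in>prime_factors n. F (if p = 2 then 2 ^ (multiplicity p n - 1)
     else p ^ (multiplicity p n - 1) * (p + 1)))"
  proof (rule sum_mono)
    fix p assume p: "p \<in> prime_factors n"
    then have pr: "prime p" by auto
    from p obtain m where m: "multiplicity p n = Suc m"
      by (auto simp: prime_factors_multiplicity gr0_conv_Suc)
    show "multiplicity p n * F p - (if p = 2 then 1 else 0) \<le> F (if p = 2 then 2 ^ (multiplicity p n - 1)
     else p ^ (multiplicity p n - 1) * (p + 1))"
    proof (cases "p = 2")
      case True
      then show ?thesis using m power[of 2 m] two by (auto simp: algebra_simps)
    next
      case False
      then have "odd p" using pr primes_dvd_imp_eq two_is_prime_nat by blast
      have "F (p ^ m * (p + 1)) = m * F p + F (p + 1)"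
        using pr by (subst mult) (auto simp: power prime_gt_0_nat)
      then show ?thesis using False m odd_prime[OF pr \<open>odd p\<close>] by (simp add: algebra_simps)
    qed
  qed
  also have "\<dots> = F (psibar n)"
    unfolding psibar_def by (rule prod[symmetric]) (auto simp: in_prime_factors_iff prime_gt_0_nat)
  finally show ?thesis .
qed

text \<open>Induction on the number of iterations. The unit that an even \<open>psibar n\<close> may
  lose is paid by the step from \<open>n\<close> to \<open>psibar n\<close>. The summand for even
  \<open>n\<close> is attained at 2, where \<open>F 2 = 1\<close> and no iteration is left.\<close>

lemma le_psi_lambda:
  assumes "n > 1"
  shows "F n \<le> psi_lambda n + of_bool (even n)"
  using assms
proof (induction "psi_lambda n" arbitrary: n)
  case 0
  then have "n = 2" using funpow_psi_lambda[of n] by simp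
  then show ?case using two by simp
next
  case (Suc k)
  show ?case
  proof (cases "n = 2")
    case True
    then show ?thesis using two by simp
  next
    case False
    then have "n > 2" using Suc by simp
    then have step: "psi_lambda n = Suc (psi_lambda (psibar n))" by (rule psi_lambda_step)
    then have "F (psibar n) \<le> psi_lambda (psibar n) + of_bool (even (psibar n))"
      using Suc(2) psibar_gt_1[OF \<open>n > 2\<close>] by (intro Suc(1)) auto
    moreover have "real (psi_lambda (psibar n) + of_bool (even (psibar n))) \<le> real (psi_lambda n)"
      unfolding step of_nat_le_iff by simp
    ultimately have "F (psibar n) \<le> psi_lambda n" by linarith
    then show ?thesis using psibar_ge[of n] \<open>n > 2\<close> by simp
  qed
qed

end

section \<open>The logarithm with gains at selected primes\<close>

abbreviation primes5 :: "nat set" where "primes5 \<equiv> {p. prime p \<and> p mod 6 = 5}"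

text \<open>
  The prime 3 contributes \<open>\<lambda>(3) - log\<^sub>2 3 = 2 - log\<^sub>2 3\<close>, and it divides \<open>p + 1\<close>
  for every \<open>p\<close> congruent to 5 modulo 6.
\<close>

definition eta_gain :: real where "eta_gain = 2 - log 2 3"

lemma eta_gain_pos: "eta_gain > 0"
proof -
  have "log 2 3 < log 2 (4::real)" by simp
  also have "log 2 (4::real) = log 2 (2 powr 2)" by simp
  also have "\<dots> = 2" by (subst log_powr_cancel) auto
  finally show ?thesis by (simp add: eta_gain_def)
qed

text \<open>\<open>eta_gain\<close> is the most that 3 tolerates, because
  \<open>log 2 3 + eta_gain = 2 = log 2 4\<close>. A prime congruent to 5 modulo 6 gets the same
  gain, so that the factor 3 of \<open>p + 1\<close> can repay it.\<close>

definition gain :: "nat \<Rightarrow> real" where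
  "gain p = (if p = 3 \<or> p mod 6 = 5 then eta_gain else 0)"

lemma gain_nonneg: "gain p \<ge> 0"
  using eta_gain_pos by (simp add: gain_def)

definition log_gain :: "nat \<Rightarrow> real" where
  "log_gain n = log 2 n + (\<Sum>p\<in>#prime_factorization n. gain p)"

text \<open>Gains are nonnegative, so repeated prime factors and those outside \<open>A\<close> may
  be dropped from the sum.\<close>

lemma log_gain_ge:
  assumes "n > 0" "A \<subseteq> prime_factors n"
  shows "log_gain n \<ge> log 2 n + (\<Sum>p\<in>A. gain p)"
proof -
  have "finite A" using assms finite_subset by blast
  have "mset_set A \<subseteq># mset_set (prime_factors n)"
    using assms by (intro subset_imp_msubset_mset_set) auto
  also have "\<dots> \<subseteq># prime_factorization n" by (rule mset_set_set_mset_msubset)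
  finally obtain B where "prime_factorization n = mset_set A + B" by (metis mset_subset_eq_exists_conv)
  then have "(\<Sum>p\<in>#prime_factorization n. gain p) = (\<Sum>p\<in>A. gain p) + (\<Sum>p\<in>#B. gain p)"
    by (simp add: sum_unfold_sum_mset)
  moreover have "(\<Sum>p\<in>#B. gain p) \<ge> 0" by (induction B) (auto simp: gain_nonneg)
  ultimately show ?thesis by (simp add: log_gain_def)
qed

lemma dvd_Suc_of_5_mod_6: "p mod 6 = 5 \<Longrightarrow> 3 dvd (p + 1 :: nat)"
  by presburger

text \<open>For the inequality at odd primes: both sides are 2 at \<open>p = 3\<close>; for
  \<open>p\<close> congruent to 5 modulo 6 the factor 3 of \<open>p + 1\<close> restores the gain of
  \<open>p\<close>; every other odd prime has no gain.\<close>

interpretation log_gain: additive_weight log_gain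
proof
  show "log_gain (m * n) = log_gain m + log_gain n" if "m > 0" "n > 0" for m n
    using that by (simp add: log_gain_def log_mult prime_factorization_mult)
  have "gain 2 = 0" by (simp add: gain_def)
  then show "log_gain 2 = 1" by (simp add: log_gain_def prime_factorization_prime)
  show "log_gain p \<le> log_gain (p + 1)" if p: "prime p" "odd p" for p
  proof -
    have log: "log 2 p \<le> log 2 (p + 1)" using p by (simp add: prime_gt_0_nat)
    have lp: "log_gain p = log 2 p + gain p"
      using p by (simp add: log_gain_def prime_factorization_prime)
    have "p = 3 \<or> p mod 6 = 5 \<or> gain p = 0" by (auto simp: gain_def)
    then show ?thesis
    proof (elim disjE)
      assume "p = 3"
      moreover have "log 2 (4::real) = 2" using log_powr_cancel[of 2 2] by simp
      ultimately show ?thesis using lp log_gain_ge[of 4 "{}"] by (simp add: gain_def eta_gain_def)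
    next
      assume m: "p mod 6 = 5"
      then have "gain p = gain 3" by (simp add: gain_def)
      moreover have "{3} \<subseteq> prime_factors (p + 1)"
        using dvd_Suc_of_5_mod_6[OF m] by (auto simp: in_prime_factors_iff)
      ultimately show ?thesis using log lp log_gain_ge[of "p + 1" "{3}"] by simp
    next
      assume "gain p = 0"
      then show ?thesis using log lp log_gain_ge[of "p + 1" "{}"] by simp
    qed
  qed
qed

text \<open>The first iterate of \<open>q\<close> is \<open>q + 1\<close>. The unit lost by the
  lower bound at this even number equals the one iteration just made, so the whole gain of the
  primes in \<open>A\<close> survives.\<close>

lemma psi_eta_ge:
  assumes q: "prime q" "odd q" and A: "A \<subseteq> primes5" "\<And>p. p \<in> A \<Longrightarrow> p dvd q + 1"
  shows "psi_eta q \<ge> card A * eta_gain"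
proof -
  have "q \<noteq> 2" "q \<ge> 2" using q by (auto simp: prime_ge_2_nat)
  then have q2: "q > 2" by simp
  have q': "psibar q = q + 1" using psibar_prime_power_odd[of q 1] q by simp
  have "A \<subseteq> prime_factors (q + 1)" using A by (auto simp: in_prime_factors_iff)
  then have "log 2 (q + 1) + (\<Sum>p\<in>A. gain p) \<le> log_gain (q + 1)"
    using log_gain_ge[of "q + 1" A] by simp
  also have "\<dots> \<le> psi_lambda (q + 1) + 1"
    using log_gain.le_psi_lambda[of "q + 1"] q q2 by simp
  also have "\<dots> = psi_lambda q" using psi_lambda_step[OF q2] q' by simp
  finally have "log 2 (q + 1) + (\<Sum>p\<in>A. gain p) \<le> psi_lambda q" .
  moreover have "(\<Sum>p\<in>A. gain p) = (\<Sum>p\<in>A. eta_gain)"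
    using A by (intro sum.cong) (auto simp: gain_def)
  moreover have "log 2 q \<le> log 2 (q + 1)" using q2 by simp
  ultimately show ?thesis unfolding psi_eta_def by simp
qed

section \<open>Primes congruent to 5 modulo 6\<close>

text \<open>\<open>M\<close> is invertible modulo \<open>d\<close>, so the admissible
  \<open>k\<close> form one residue class modulo \<open>d\<close>, and the first \<open>N\<close>
  natural numbers contain \<open>N div d\<close> or one more of them.\<close>

lemma card_progression_multiples:
  fixes a M d N :: nat
  assumes "coprime M d" "d > 0"
  shows "\<bar>real (card {k. k < N \<and> d dvd a + M * k}) - N / d\<bar> \<le> 1"
proof -
  from cong_solve_coprime_nat[OF assms(1)] obtain x where x: "[M * x = 1] (mod d)" by auto
  \<comment> \<open>Here \<open>(d - 1) * a\<close> stands for \<open>-a\<close> in the natural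
    numbers, so \<open>r\<close> solves \<open>a + M * r = 0\<close> modulo
    \<open>d\<close>.\<close>
  define r where "r = (x * ((d - 1) * a)) mod d"
  have "[M * r = M * (x * ((d - 1) * a))] (mod d)"
    unfolding r_def by (intro cong_scalar_left) simp
  also have "M * (x * ((d - 1) * a)) = (M * x) * ((d - 1) * a)" by simp
  also have "[\<dots> = 1 * ((d - 1) * a)] (mod d)" by (intro cong_scalar_right x)
  finally have "[a + M * r = a + (d - 1) * a] (mod d)" by (intro cong_add) auto
  also have "a + (d - 1) * a = d * a" using assms(2) by (cases d) auto
  finally have dr: "d dvd a + M * r" by (simp add: cong_def mod_eq_0_iff_dvd)
  have r: "r < d" using assms(2) by (simp add: r_def)
  have iff: "d dvd a + M * k \<longleftrightarrow> k mod d = r" for k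
  proof -
    have "d dvd a + M * k \<longleftrightarrow> [a + M * k = a + M * r] (mod d)"
      using dr by (simp add: cong_def dvd_eq_mod_eq_0)
    also have "\<dots> \<longleftrightarrow> [k = r] (mod d)"
      using assms(1) by (simp add: cong_add_lcancel_nat cong_mult_lcancel_nat)
    also have "\<dots> \<longleftrightarrow> k mod d = r" using r by (simp add: cong_def)
    finally show ?thesis .
  qed
  let ?A = "{k. k < N \<and> d dvd a + M * k}"
  have inj: "inj_on (\<lambda>j. r + j * d) B" for B using assms(2) by (auto intro: inj_onI)
  have "(\<lambda>j. r + j * d) ` {..<N div d} \<subseteq> ?A"
  proof clarify
    fix j assume "j < N div d"
    then have "j + 1 \<le> N div d" by simp
    then have "(j + 1) * d \<le> N" using assms(2) by (metis div_times_less_eq_dividend le_trans mult_le_mono1)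
    then show "r + j * d < N \<and> d dvd a + M * (r + j * d)" using r by (simp add: iff)
  qed
  from card_mono[OF _ this] have lo: "N div d \<le> card ?A"
    by (simp add: card_image[OF inj])
  have "?A \<subseteq> (\<lambda>j. r + j * d) ` {..<N div d + 1}"
  proof clarify
    fix k assume k: "k < N" "d dvd a + M * k"
    then have "k = r + (k div d) * d" using iff[of k] mod_div_mult_eq[of k d] by simp
    moreover have "k div d < N div d + 1" using k(1) by (simp add: div_le_mono less_Suc_eq_le)
    ultimately show "k \<in> (\<lambda>j. r + j * d) ` {..<N div d + 1}" by blast
  qed
  from card_mono[OF _ this] have hi: "card ?A \<le> N div d + 1"
    by (simp add: card_image[OF inj])
  have N: "real N = real d * real (N div d) + real (N mod d)"
    unfolding of_nat_mult[symmetric] of_nat_add[symmetric] by simp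
  have "real (N mod d) < real d" using assms(2) by simp
  then have "N / d \<le> real (N div d) + 1" using N assms(2) by (simp add: field_simps)
  moreover have "real (N div d) \<le> N / d" using N assms(2) by (simp add: field_simps)
  ultimately show ?thesis using lo hi by linarith
qed

text \<open>A product is congruent to 5 modulo 6 only if one of its factors is. Split off a prime
  factor and, if it lies in another class, pass to the cofactor.\<close>

lemma ex_prime_factor_5_mod_6:
  fixes n :: nat
  assumes "n mod 6 = 5"
  shows "\<exists>p\<in>primes5. p dvd n"
  using assms
proof (induction n rule: less_induct)
  case (less n)
  have "n \<noteq> 1" using less.prems by auto
  then obtain p where p: "prime p" "p dvd n" using prime_factor_nat by blast
  then obtain m where n: "n = p * m" by (elim dvdE)
  have n0: "n > 0" using less.prems by (cases n) auto
  have "(p mod 6) * (m mod 6) mod 6 = 5" using less.prems n by (simp add: mod_mult_eq)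
  moreover have "p mod 6 < 6" "m mod 6 < 6" by auto
  then have "p mod 6 \<in> {0,1,2,3,4,5}" "m mod 6 \<in> {0,1,2,3,4,5}" by auto
  ultimately have "p mod 6 = 5 \<or> m mod 6 = 5" by auto
  then show ?case
  proof
    assume "p mod 6 = 5" then show ?thesis using p by blast
  next
    assume "m mod 6 = 5"
    moreover have "m < n" unfolding n using n n0 prime_gt_1_nat[OF p(1)] by simp
    ultimately obtain r where "r \<in> primes5" "r dvd m" using less.IH by blast
    then show ?thesis using n by auto
  qed
qed

text \<open>
  A Euclid-style argument: a number \<open>M k - 1\<close>, where \<open>6\<close> and all primes up to \<open>y\<close> in the
  class 5 modulo 6 divide \<open>M\<close>, has a prime factor in the class beyond \<open>y\<close>; if the
  reciprocals were summable, there would be too few multiples of such primes.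
\<close>

lemma not_summable_primes5: "\<not> summable (\<lambda>p. if p \<in> primes5 then 1 / real p else 0)"
proof
  assume s: "summable (\<lambda>p. if p \<in> primes5 then 1 / real p else 0)"
  have tail: "\<exists>y. \<forall>x. (\<Sum>p | p \<in> primes5 \<and> y \<le> p \<and> p < x. 1 / real p) < e" if "e > 0" for e :: real
  proof -
    let ?f = "\<lambda>p. if p \<in> primes5 then 1 / real p else 0"
    have "\<forall>e>0. \<exists>y. \<forall>m\<ge>y. \<forall>x. norm (sum ?f {m..<x}) < e"
      using s by (rule iffD1[OF summable_Cauchy])
    with \<open>e > 0\<close> obtain y where y: "\<forall>m\<ge>y. \<forall>x. norm (sum ?f {m..<x}) < e" by meson
    have "(\<Sum>p | p \<in> primes5 \<and> y \<le> p \<and> p < x. 1 / real p) < e" for x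
    proof -
      have "(\<Sum>p | p \<in> primes5 \<and> y \<le> p \<and> p < x. 1 / real p) = sum ?f {y..<x}"
        by (intro sum.mono_neutral_cong_left) auto
      moreover have "\<bar>sum ?f {y..<x}\<bar> < e" using y unfolding real_norm_def by blast
      ultimately show ?thesis by linarith
    qed
    then show ?thesis by blast
  qed
  obtain y where y: "\<And>x. (\<Sum>p | p \<in> primes5 \<and> y \<le> p \<and> p < x. 1 / real p) < 1 / 4"
    using tail[of "1/4"] by auto
  define Q where "Q = {p \<in> primes5. p < y}"
  have "finite Q" unfolding Q_def by simp
  define M where "M = 6 * \<Prod>Q"
  have M0: "M > 0" unfolding M_def Q_def by (auto intro!: prod_pos simp: prime_gt_0_nat)
  \<comment> \<open>The second threshold controls the rounding error of 1 per prime: beyond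
    \<open>z\<close> the tail is small even after multiplication by \<open>M\<close>, so few primes
    up to \<open>M * K\<close> remain.\<close>
  obtain z where z: "\<And>x. (\<Sum>p | p \<in> primes5 \<and> z \<le> p \<and> p < x. 1 / real p) < 1 / (4 * real M)"
    using tail[of "1 / (4 * real M)"] M0 by auto
  \<comment> \<open>The final inequality reads \<open>K \<le> K / 4 + (z + K / 4)\<close>, which
    fails as soon as \<open>K > 2 * z\<close>.\<close>
  define K where "K = 2 * (z + 1)"
  define R where "R = {p \<in> primes5. y \<le> p \<and> p < M * K + 1 \<and> coprime M p}"
  have finR: "finite R" unfolding R_def by simp
  \<comment> \<open>The number \<open>(M - 1) + M * k\<close> equals \<open>M * (k + 1) - 1\<close>,
    hence is 5 modulo 6 and coprime to \<open>M\<close>.\<close>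
  let ?A = "\<lambda>p. {k. k < K \<and> p dvd (M - 1) + M * k}"
  have "{..<K} \<subseteq> (\<Union>p\<in>R. ?A p)"
  proof
    fix k assume "k \<in> {..<K}"
    then have k: "k < K" by simp
    define n where "n = (M - 1) + M * k"
    have n1: "n + 1 = M * (k + 1)" using M0 by (simp add: n_def)
    then have "6 dvd n + 1" by (simp add: M_def)
    then have "n mod 6 = 5" by presburger
    from ex_prime_factor_5_mod_6[OF this] obtain p where p: "p \<in> primes5" "p dvd n" by blast
    have "\<not> p dvd M"
    proof
      assume "p dvd M"
      then have "p dvd n + 1" using n1 by simp
      then have "p dvd 1" using p(2) dvd_add_right_iff[of p n 1] by simp
      then show False using p(1) by auto
    qed
    then have cop: "coprime M p" using p(1) prime_imp_coprime[of p M] \<open>\<not> p dvd M\<close> by (simp add: coprime_commute)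
    have "y \<le> p"
    proof (rule ccontr)
      assume "\<not> y \<le> p"
      then have "p \<in> Q" using p(1) by (simp add: Q_def)
      then have "p dvd \<Prod>Q" using \<open>finite Q\<close> dvd_prodI[of Q p "\<lambda>x. x"] by simp
      then have "p dvd M" by (simp add: M_def)
      then show False using \<open>\<not> p dvd M\<close> by simp
    qed
    moreover have "n > 0" using \<open>n mod 6 = 5\<close> by (cases n) auto
    then have "p \<le> n" using p(2) by (intro dvd_imp_le)
    moreover have "n + 1 \<le> M * K" unfolding n1 using k by (intro mult_le_mono2) simp
    ultimately have "p \<in> R" using p(1) cop by (simp add: R_def)
    then show "k \<in> (\<Union>p\<in>R. ?A p)" using k p(2) n_def by blast
  qed
  then have "K \<le> card (\<Union>p\<in>R. ?A p)"
    using card_mono[of "\<Union>p\<in>R. ?A p" "{..<K}"] finR by simp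
  also have "\<dots> \<le> (\<Sum>p\<in>R. card (?A p))" by (rule card_UN_le[OF finR])
  finally have "real K \<le> (\<Sum>p\<in>R. real (card (?A p)))"
    by (simp only: of_nat_sum[symmetric] of_nat_le_iff)
  also have "\<dots> \<le> (\<Sum>p\<in>R. real K * (1 / real p) + 1)"
  proof (rule sum_mono)
    fix p assume "p \<in> R"
    then have "coprime M p" "p > 0" by (auto simp: R_def prime_gt_0_nat)
    from card_progression_multiples[OF this, of K "M - 1"]
    have "real (card (?A p)) \<le> real K / real p + 1" by linarith
    then show "real (card (?A p)) \<le> real K * (1 / real p) + 1" by simp
  qed
  also have "\<dots> = real K * (\<Sum>p\<in>R. 1 / real p) + card R"
    by (simp add: sum.distrib sum_distrib_left)
  finally have main: "real K \<le> real K * (\<Sum>p\<in>R. 1 / real p) + card R" .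
  have "(\<Sum>p\<in>R. 1 / real p) \<le> (\<Sum>p | p \<in> primes5 \<and> y \<le> p \<and> p < M * K + 1. 1 / real p)"
    by (rule sum_mono2) (auto simp: R_def)
  also have "\<dots> \<le> 1 / 4" using y by (rule less_imp_le)
  finally have "real K * (\<Sum>p\<in>R. 1 / real p) \<le> real K * (1 / 4)" by (intro mult_left_mono) auto
  moreover have "real (card R) \<le> z + real K / 4"
  proof -
    let ?Z = "{p \<in> primes5. z \<le> p \<and> p < M * K + 1}"
    have "R \<subseteq> {..<z} \<union> ?Z" by (auto simp: R_def)
    then have "card R \<le> card ({..<z} \<union> ?Z)" by (intro card_mono) auto
    also have "\<dots> \<le> card {..<z} + card ?Z" by (rule card_Un_le)
    finally have "card R \<le> z + card ?Z" by simp
    moreover have "real (card ?Z) \<le> real K / 4"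
    proof -
      have "real (card ?Z) = (\<Sum>p\<in>?Z. 1)" by simp
      \<comment> \<open>Each \<open>p\<close> counted here is at most \<open>M * K\<close>, so the
        summand 1 is at most \<open>M * K / p\<close>.\<close>
      also have "\<dots> \<le> (\<Sum>p\<in>?Z. real (M * K) * (1 / real p))"
        by (intro sum_mono) (auto simp: prime_gt_0_nat field_simps simp flip: of_nat_mult)
      also have "\<dots> = real (M * K) * (\<Sum>p\<in>?Z. 1 / real p)" by (simp add: sum_distrib_left)
      also have "\<dots> \<le> real (M * K) * (1 / (4 * real M))"
        using z[of "M * K + 1"] by (intro mult_left_mono) (auto intro: less_imp_le)
      also have "\<dots> = real K / 4" using M0 by simp
      finally show ?thesis .
    qed
    ultimately show ?thesis by linarith
  qed
  ultimately have "real K \<le> real K * (1 / 4) + (z + real K / 4)" using main by linarith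
  then show False by (simp add: K_def)
qed

section \<open>Selberg's sieve\<close>

text \<open>Moebius inversion on the Boolean lattice: writing \<open>I = R \<union> K\<close> leaves
  the expansion of a product of factors \<open>-1 + 1\<close> over \<open>J - R\<close>.\<close>

lemma sum_alternating_interval:
  assumes "finite J" "R \<subseteq> J"
  shows "(\<Sum>I | R \<subseteq> I \<and> I \<subseteq> J. (-1) ^ card I :: real) = (if J = R then (-1) ^ card R else 0)"
proof -
  have fR: "finite R" using assms by (rule finite_subset[rotated])
  have bij: "bij_betw (\<lambda>K. R \<union> K) (Pow (J - R)) {I. R \<subseteq> I \<and> I \<subseteq> J}"
    by (rule bij_betwI[where g = "\<lambda>I. I - R"]) (use assms in auto)
  have "(\<Sum>I | R \<subseteq> I \<and> I \<subseteq> J. (-1) ^ card I :: real) = (\<Sum>K\<in>Pow (J - R). (-1) ^ card (R \<union> K))"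
    by (rule sum.reindex_bij_betw[OF bij, symmetric])
  also have "\<dots> = (\<Sum>K\<in>Pow (J - R). (-1) ^ card R * ((-1) ^ card K))"
  proof (rule sum.cong[OF refl])
    fix K assume K: "K \<in> Pow (J - R)"
    then have "finite K" using assms finite_subset by blast
    then have "card (R \<union> K) = card R + card K" using K fR by (intro card_Un_disjoint) auto
    then show "(-1) ^ card (R \<union> K) = (-1::real) ^ card R * (-1) ^ card K" by (simp add: power_add)
  qed
  also have "\<dots> = (-1) ^ card R * (\<Sum>K\<in>Pow (J - R). (\<Prod>x\<in>K. -1) * (\<Prod>x\<in>J-R-K. 1))"
    by (simp add: sum_distrib_left)
  also have "\<dots> = (-1) ^ card R * (\<Prod>x\<in>J - R. -1 + 1)"
    using assms by (subst prod_add) auto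
  also have "\<dots> = (if J = R then (-1) ^ card R else 0)"
    using assms by auto
  finally show ?thesis .
qed

text \<open>
  Finite sets of primes stand for squarefree numbers: gcd and lcm become intersection and
  union, the Moebius function becomes the sign of the cardinality.
\<close>

locale selberg_weights =
  fixes f :: "'a \<Rightarrow> real" and D :: "'a set set"
  assumes fin: "finite D" and fin_mem: "I \<in> D \<Longrightarrow> finite I"
    and down: "I \<in> D \<Longrightarrow> J \<subseteq> I \<Longrightarrow> J \<in> D"
    and empty_mem: "{} \<in> D"
    and f_gt_1: "I \<in> D \<Longrightarrow> p \<in> I \<Longrightarrow> f p > 1"
begin

text \<open>For sets of primes and \<open>f p = p\<close> this is the reciprocal of Euler's totient
  of the squarefree number, so \<open>S\<close> is Selberg's sum of
  \<open>1 / \<phi>(d)\<close>.\<close>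

definition g :: "'a set \<Rightarrow> real" where "g I = 1 / (\<Prod>p\<in>I. f p - 1)"

definition S :: real where "S = (\<Sum>I\<in>D. g I)"

text \<open>Selberg's weights in explicit form: among all weights on \<open>D\<close> with value 1
  at \<open>{}\<close> they minimise the quadratic form evaluated in
  \<open>quadratic_form_eq\<close>.\<close>

definition w :: "'a set \<Rightarrow> real" where
  "w I = (-1) ^ card I * (\<Prod>p\<in>I. f p) * (\<Sum>J | J \<in> D \<and> I \<subseteq> J. g J) / S"

lemma prod_f_pos: "I \<in> D \<Longrightarrow> (\<Prod>p\<in>I. f p) > 0"
  using f_gt_1 by (intro prod_pos) force

lemma g_pos: "I \<in> D \<Longrightarrow> g I > 0"
  unfolding g_def using f_gt_1 by (intro divide_pos_pos prod_pos) force+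

lemma S_ge_1: "S \<ge> 1"
proof -
  have "g {} \<le> S" unfolding S_def using fin empty_mem g_pos by (intro member_le_sum) (auto intro: less_imp_le)
  then show ?thesis by (simp add: g_def)
qed

lemma w_empty: "w {} = 1"
  using S_ge_1 by (simp add: w_def S_def)

text \<open>The inner sum in \<open>w I\<close> is a part of the positive sum \<open>S\<close>, so
  its quotient by \<open>S\<close> lies between 0 and 1.\<close>

lemma abs_w_le: assumes "I \<in> D" shows "\<bar>w I\<bar> \<le> (\<Prod>p\<in>I. f p)"
proof -
  let ?G = "\<Sum>J | J \<in> D \<and> I \<subseteq> J. g J"
  have "?G \<le> S" unfolding S_def using fin g_pos by (intro sum_mono2) (auto intro: less_imp_le)
  moreover have "?G \<ge> 0" using g_pos by (intro sum_nonneg) (auto intro: less_imp_le)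
  ultimately have "(\<Prod>p\<in>I. f p) * (?G / S) \<le> (\<Prod>p\<in>I. f p) * 1"
    using S_ge_1 prod_f_pos[OF assms] by (intro mult_left_mono) (auto simp: divide_le_eq)
  moreover have "\<bar>w I\<bar> = (\<Prod>p\<in>I. f p) * (?G / S)"
    unfolding w_def using S_ge_1 prod_f_pos[OF assms] \<open>?G \<ge> 0\<close> by (simp add: abs_mult power_abs)
  ultimately show ?thesis by simp
qed

text \<open>After exchanging the sums over \<open>I\<close> and \<open>J\<close>, the signs cancel
  on each interval between \<open>R\<close> and \<open>J\<close> unless \<open>J = R\<close>;
  \<open>down\<close> places the whole interval inside \<open>D\<close>.\<close>

lemma sum_weights_above:
  assumes R: "R \<in> D"
  shows "(\<Sum>I\<in>D. of_bool (R \<subseteq> I) * (w I / (\<Prod>p\<in>I. f p))) = (-1) ^ card R * g R / S"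
proof -
  have "(\<Sum>I\<in>D. of_bool (R \<subseteq> I) * (w I / (\<Prod>p\<in>I. f p))) =
    (\<Sum>I\<in>D. \<Sum>J\<in>D. of_bool (R \<subseteq> I) * of_bool (I \<subseteq> J) * (-1) ^ card I * g J / S)"
  proof (rule sum.cong[OF refl])
    fix I assume I: "I \<in> D"
    have "w I / (\<Prod>p\<in>I. f p) = (-1) ^ card I * (\<Sum>J | J \<in> D \<and> I \<subseteq> J. g J) / S"
      using prod_f_pos[OF I] by (simp add: w_def)
    also have "(\<Sum>J | J \<in> D \<and> I \<subseteq> J. g J) = (\<Sum>J\<in>D. of_bool (I \<subseteq> J) * g J)"
      using fin by (intro sum.mono_neutral_cong_left) auto
    finally show "of_bool (R \<subseteq> I) * (w I / (\<Prod>p\<in>I. f p)) =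
      (\<Sum>J\<in>D. of_bool (R \<subseteq> I) * of_bool (I \<subseteq> J) * (-1) ^ card I * g J / S)"
      by (simp add: sum_distrib_left sum_divide_distrib mult_ac)
  qed
  also have "\<dots> = (\<Sum>J\<in>D. \<Sum>I\<in>D. of_bool (R \<subseteq> I) * of_bool (I \<subseteq> J) * (-1) ^ card I * g J / S)"
    by (rule sum.swap)
  also have "\<dots> = (\<Sum>J\<in>D. if J = R then (-1) ^ card R * g R / S else 0)"
  proof (rule sum.cong[OF refl])
    fix J assume J: "J \<in> D"
    have "(\<Sum>I\<in>D. of_bool (R \<subseteq> I) * of_bool (I \<subseteq> J) * (-1) ^ card I * g J / S) =
      (\<Sum>I | R \<subseteq> I \<and> I \<subseteq> J. (-1) ^ card I * (g J / S))"
      using fin down[OF J] by (intro sum.mono_neutral_cong_right) auto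
    also have "\<dots> = (\<Sum>I | R \<subseteq> I \<and> I \<subseteq> J. (-1) ^ card I) * (g J / S)"
      by (rule sum_distrib_right[symmetric])
    also have "\<dots> = (if J = R then (-1) ^ card R * g R / S else 0)"
    proof (cases "R \<subseteq> J")
      case True
      then show ?thesis using sum_alternating_interval[OF fin_mem[OF J] True] by simp
    next
      case False
      then have e: "{I. R \<subseteq> I \<and> I \<subseteq> J} = {}" by auto
      from False have "J \<noteq> R" by auto
      then show ?thesis unfolding e by simp
    qed
    finally show "(\<Sum>I\<in>D. of_bool (R \<subseteq> I) * of_bool (I \<subseteq> J) * (-1) ^ card I * g J / S) =
      (if J = R then (-1) ^ card R * g R / S else 0)" .
  qed
  also have "\<dots> = (-1) ^ card R * g R / S" using R fin by (simp add: sum.delta)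
  finally show ?thesis .
qed

text \<open>Diagonalisation: \<open>prod f (I \<union> J) * prod f (I \<inter> J) = prod f I * prod
  f J\<close>, and expanding \<open>prod f (I \<inter> J)\<close> into the \<open>h R\<close> turns
  the form into a sum of \<open>h R\<close> times squares, whose values
  \<open>sum_weights_above\<close> supplies.\<close>

lemma quadratic_form_eq:
  "(\<Sum>I\<in>D. \<Sum>J\<in>D. w I * w J / (\<Prod>p\<in>I \<union> J. f p)) = 1 / S"
proof -
  define v where "v I = w I / (\<Prod>p\<in>I. f p)" for I
  define h where "h R = (\<Prod>p\<in>R. f p - 1)" for R
  have "(\<Sum>I\<in>D. \<Sum>J\<in>D. w I * w J / (\<Prod>p\<in>I \<union> J. f p)) =
    (\<Sum>I\<in>D. \<Sum>J\<in>D. \<Sum>R\<in>D. h R * (of_bool (R \<subseteq> I) * v I) * (of_bool (R \<subseteq> J) * v J))"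
  proof (intro sum.cong refl)
    fix I J assume I: "I \<in> D" and J: "J \<in> D"
    have "prod f (I \<union> J) * prod f (I \<inter> J) = prod f I * prod f J"
      by (rule prod.union_inter) (use fin_mem I J in auto)
    moreover have IJ: "I \<inter> J \<in> D" using down I by blast
    moreover have pos: "prod f (I \<union> J) > 0" using f_gt_1 I J by (intro prod_pos) force
    ultimately have "w I * w J / prod f (I \<union> J) = v I * v J * prod f (I \<inter> J)"
      using prod_f_pos[OF I] prod_f_pos[OF J] prod_f_pos[OF IJ] unfolding v_def by (simp add: field_simps)
    \<comment> \<open>For \<open>f p = p\<close> this expansion is the identity that Euler's
      totient, summed over the divisors of a number, gives the number.\<close>
    also have "prod f (I \<inter> J) = (\<Prod>p\<in>I\<inter>J. (f p - 1) + 1)" by simp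
    also have "\<dots> = (\<Sum>R\<in>Pow (I \<inter> J). h R)"
      unfolding h_def using fin_mem I by (subst prod_add) auto
    also have "\<dots> = (\<Sum>R\<in>D. h R * of_bool (R \<subseteq> I) * of_bool (R \<subseteq> J))"
      using fin down[OF IJ] by (intro sum.mono_neutral_cong_left) auto
    finally show "w I * w J / prod f (I \<union> J) =
      (\<Sum>R\<in>D. h R * (of_bool (R \<subseteq> I) * v I) * (of_bool (R \<subseteq> J) * v J))"
      by (simp add: sum_distrib_left mult_ac)
  qed
  also have "\<dots> = (\<Sum>I\<in>D. \<Sum>R\<in>D. \<Sum>J\<in>D. h R * (of_bool (R \<subseteq> I) * v I) * (of_bool (R \<subseteq> J) * v J))"
    by (rule sum.cong[OF refl], rule sum.swap)
  also have "\<dots> = (\<Sum>R\<in>D. \<Sum>I\<in>D. \<Sum>J\<in>D. h R * (of_bool (R \<subseteq> I) * v I) * (of_bool (R \<subseteq> J) * v J))"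
    by (rule sum.swap)
  also have "\<dots> = (\<Sum>R\<in>D. h R * ((\<Sum>I\<in>D. of_bool (R \<subseteq> I) * v I) * (\<Sum>J\<in>D. of_bool (R \<subseteq> J) * v J)))"
    unfolding sum_product by (simp add: sum_distrib_left mult.assoc)
  also have "\<dots> = (\<Sum>R\<in>D. g R / S\<^sup>2)"
  proof (rule sum.cong[OF refl])
    fix R assume R: "R \<in> D"
    have hg: "h R * g R = 1" using g_pos[OF R] unfolding h_def g_def by simp
    have "(-1) ^ card R * (-1) ^ card R = (1::real)" by (simp flip: power_mult_distrib)
    then have "h R * (((-1) ^ card R * g R / S) * ((-1) ^ card R * g R / S)) = h R * g R * g R / S\<^sup>2"
      by (simp add: power2_eq_square algebra_simps)
    then show "h R * ((\<Sum>I\<in>D. of_bool (R \<subseteq> I) * v I) * (\<Sum>J\<in>D. of_bool (R \<subseteq> J) * v J)) = g R / S\<^sup>2"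
      unfolding v_def sum_weights_above[OF R] hg by simp
  qed
  also have "\<dots> = S / S\<^sup>2" by (simp add: S_def sum_divide_distrib)
  also have "\<dots> = 1 / S" by (simp add: power2_eq_square)
  finally show ?thesis .
qed

text \<open>
  The indicator of the sifted set is at most the square of the weight sum, because only
  the empty set contributes there, with weight 1.
\<close>

lemma sifted_card_le:
  fixes A :: "'b set" and hits :: "'b \<Rightarrow> 'a \<Rightarrow> bool" and X E :: real
  assumes A: "finite A"
    and count: "\<And>I J. I \<in> D \<Longrightarrow> J \<in> D \<Longrightarrow>
      \<bar>real (card {n\<in>A. \<forall>p\<in>I \<union> J. hits n p}) - X / (\<Prod>p\<in>I \<union> J. f p)\<bar> \<le> 1"
    and E: "\<And>I. I \<in> D \<Longrightarrow> (\<Prod>p\<in>I. f p) \<le> E"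
  shows "real (card {n\<in>A. \<forall>p\<in>\<Union>D. \<not> hits n p}) \<le> X / S + (real (card D) * E)\<^sup>2"
proof -
  define W where "W n = (\<Sum>I\<in>D. of_bool (\<forall>p\<in>I. hits n p) * w I)" for n
  have "real (card {n\<in>A. \<forall>p\<in>\<Union>D. \<not> hits n p}) = (\<Sum>n\<in>A. of_bool (\<forall>p\<in>\<Union>D. \<not> hits n p))"
    using A by (simp add: sum.If_cases Int_def)
  also have "\<dots> \<le> (\<Sum>n\<in>A. (W n)\<^sup>2)"
  proof (rule sum_mono)
    fix n assume "n \<in> A"
    show "of_bool (\<forall>p\<in>\<Union>D. \<not> hits n p) \<le> (W n)\<^sup>2"
    proof (cases "\<forall>p\<in>\<Union>D. \<not> hits n p")
      case True
      have "W n = (\<Sum>I\<in>D. if I = {} then w {} else 0)" unfolding W_def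
        using True by (intro sum.cong) auto
      then have "W n = 1" using fin empty_mem w_empty by (simp add: sum.delta)
      then show ?thesis by simp
    next
      case False
      then have "of_bool (\<forall>p\<in>\<Union>D. \<not> hits n p) = (0::real)" by (rule iffD2[OF of_bool_eq_0_iff])
      then show ?thesis using zero_le_power2[of "W n"] by (rule ord_eq_le_trans)
    qed
  qed
  also have "\<dots> = (\<Sum>n\<in>A. \<Sum>I\<in>D. \<Sum>J\<in>D. w I * w J * of_bool (\<forall>p\<in>I \<union> J. hits n p))"
    unfolding W_def power2_eq_square sum_product
    by (intro sum.cong refl) auto
  also have "\<dots> = (\<Sum>I\<in>D. \<Sum>n\<in>A. \<Sum>J\<in>D. w I * w J * of_bool (\<forall>p\<in>I \<union> J. hits n p))"
    by (rule sum.swap)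
  also have "\<dots> = (\<Sum>I\<in>D. \<Sum>J\<in>D. \<Sum>n\<in>A. w I * w J * of_bool (\<forall>p\<in>I \<union> J. hits n p))"
    by (rule sum.cong[OF refl], rule sum.swap)
  also have "\<dots> = (\<Sum>I\<in>D. \<Sum>J\<in>D. w I * w J * real (card {n\<in>A. \<forall>p\<in>I \<union> J. hits n p}))"
    using A by (simp add: sum_distrib_left[symmetric] sum.If_cases Int_def)
  \<comment> \<open>Replacing each count by its main term costs at most
    \<open>\<bar>w I\<bar> * \<bar>w J\<bar>\<close>; the main terms assemble into the quadratic
    form.\<close>
  also have "\<dots> \<le> (\<Sum>I\<in>D. \<Sum>J\<in>D. X * (w I * w J / (\<Prod>p\<in>I \<union> J. f p)) + \<bar>w I\<bar> * \<bar>w J\<bar>)"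
  proof (intro sum_mono)
    fix I J assume I: "I \<in> D" and J: "J \<in> D"
    let ?c = "real (card {n\<in>A. \<forall>p\<in>I \<union> J. hits n p})"
    have "w I * w J * ?c - w I * w J * (X / prod f (I \<union> J)) = w I * w J * (?c - X / prod f (I \<union> J))"
      by (simp add: algebra_simps)
    also have "\<dots> \<le> \<bar>w I * w J\<bar> * \<bar>?c - X / prod f (I \<union> J)\<bar>"
      by (subst abs_mult[symmetric]) (rule abs_ge_self)
    also have "\<dots> \<le> \<bar>w I * w J\<bar> * 1" using count[OF I J] by (intro mult_left_mono) auto
    finally show "w I * w J * ?c \<le> X * (w I * w J / prod f (I \<union> J)) + \<bar>w I\<bar> * \<bar>w J\<bar>"
      by (simp add: abs_mult mult_ac)
  qed
  also have "\<dots> = X * (\<Sum>I\<in>D. \<Sum>J\<in>D. w I * w J / (\<Prod>p\<in>I \<union> J. f p)) + (\<Sum>I\<in>D. \<bar>w I\<bar>)\<^sup>2"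
    unfolding power2_eq_square sum_product by (simp add: sum.distrib sum_distrib_left)
  also have "\<dots> \<le> X / S + (real (card D) * E)\<^sup>2"
  proof -
    have "(\<Sum>I\<in>D. \<bar>w I\<bar>) \<le> of_nat (card D) * E"
      using abs_w_le E by (intro sum_bounded_above) force
    then have "(\<Sum>I\<in>D. \<bar>w I\<bar>)\<^sup>2 \<le> (real (card D) * E)\<^sup>2"
      by (intro power_mono sum_nonneg) auto
    then show ?thesis unfolding quadratic_form_eq by simp
  qed
  finally show ?thesis .
qed

end

section \<open>A logarithmic lower bound for Selberg's sum\<close>

lemma ln_le_sum_inverse: "ln (real n + 1) \<le> (\<Sum>k=1..n. 1 / real k)"
proof (induction n)
  case (Suc n)
  have "x + 1 = x * (1 + 1 / x)" if "x > 0" for x :: real using that by (simp add: field_simps)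
  from this[of "real (Suc n)"]
  have "ln (real (Suc n) + 1) = ln ((real n + 1) * (1 + 1 / real (Suc n)))" by (simp add: add.commute)
  also have "\<dots> = ln (real n + 1) + ln (1 + 1 / real (Suc n))"
    by (subst ln_mult) (auto simp: field_simps add_pos_pos)
  also have "ln (1 + 1 / real (Suc n)) \<le> 1 / real (Suc n)" by (intro ln_add_one_self_le_self) simp
  finally show ?case using Suc by simp
qed simp

lemma sum_power_le: "0 \<le> x \<Longrightarrow> x < 1 \<Longrightarrow> (\<Sum>k=1..n. x ^ k) \<le> x / (1 - x)" for x :: real
proof -
  assume x: "0 \<le> x" "x < 1"
  have "(\<Sum>k=1..n. x ^ k) = (x - x ^ Suc n) / (1 - x)"
    using x by (subst sum_gp) auto
  also have "\<dots> \<le> x / (1 - x)" using x by (intro divide_right_mono) auto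
  finally show ?thesis .
qed

text \<open>By unique factorisation these reciprocals are distinct terms in the expansion of a
  product of geometric series over \<open>R\<close> with exponents from 1 on; each series is at most
  \<open>1 / (p - 1)\<close>.\<close>

lemma sum_inverse_support_le:
  assumes "finite R" "\<And>p. p \<in> R \<Longrightarrow> prime p"
  shows "(\<Sum>n | n \<in> {1..N} \<and> prime_factors n = R. 1 / real n) \<le> (\<Prod>p\<in>R. 1 / (real p - 1))"
proof -
  let ?A = "{n. n \<in> {1..N} \<and> prime_factors n = R}"
  \<comment> \<open>Restriction to \<open>R\<close> makes the exponent vector extensional, as
    membership in \<open>PiE\<close> requires.\<close>
  define v where "v n = restrict (\<lambda>p. multiplicity p n) R" for n
  have n_eq: "n = (\<Prod>p\<in>R. p ^ v n p)" if "n \<in> ?A" for n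
    using prime_factorization_nat[of n] that by (auto simp: v_def)
  have inj: "inj_on v ?A" by (rule inj_onI) (metis n_eq)
  have sub: "v ` ?A \<subseteq> PiE R (\<lambda>_. {1..N})"
  proof clarify
    fix n assume n: "n \<in> {1..N}" "R = prime_factors n"
    have "multiplicity p n \<in> {1..N}" if "p \<in> prime_factors n" for p
    proof -
      have "multiplicity p n < 2 ^ multiplicity p n" by (rule less_exp)
      moreover have "2 ^ multiplicity p n \<le> p ^ multiplicity p n"
        using that by (intro power_mono prime_ge_2_nat) auto
      moreover have "p ^ multiplicity p n \<le> n" using n by (intro dvd_imp_le multiplicity_dvd) auto
      ultimately have "multiplicity p n \<le> n" by linarith
      moreover have "multiplicity p n > 0" using that by (simp add: prime_factors_multiplicity)
      ultimately show ?thesis using n by simp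
    qed
    then show "v n \<in> PiE (prime_factors n) (\<lambda>_. {1..N})" unfolding v_def n(2) by auto
  qed
  have "(\<Sum>n\<in>?A. 1 / real n) = (\<Sum>n\<in>?A. \<Prod>p\<in>R. (1 / real p) ^ v n p)"
  proof (rule sum.cong[OF refl])
    fix n assume "n \<in> ?A"
    then have "real n = real (\<Prod>p\<in>R. p ^ v n p)" by (intro arg_cong[where f = real] n_eq)
    then have "real n = (\<Prod>p\<in>R. real p ^ v n p)" by simp
    then show "1 / real n = (\<Prod>p\<in>R. (1 / real p) ^ v n p)"
      by (simp add: prod_dividef power_one_over)
  qed
  also have "\<dots> = (\<Sum>f\<in>v ` ?A. \<Prod>p\<in>R. (1 / real p) ^ f p)"
    by (subst sum.reindex[OF inj]) (simp only: o_def)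
  also have "\<dots> \<le> (\<Sum>f\<in>PiE R (\<lambda>_. {1..N}). \<Prod>p\<in>R. (1 / real p) ^ f p)"
    using assms(1) sub by (intro sum_mono2 finite_PiE) (auto intro!: prod_nonneg)
  also have "\<dots> = (\<Prod>p\<in>R. \<Sum>k=1..N. (1 / real p) ^ k)"
    using assms(1) by (intro prod_sum_PiE[symmetric]) auto
  also have "\<dots> \<le> (\<Prod>p\<in>R. 1 / (real p - 1))"
  proof (rule prod_mono)
    fix p assume "p \<in> R"
    then have p: "real p > 1" using assms(2) prime_gt_1_nat by auto
    have "(\<Sum>k=1..N. (1 / real p) ^ k) \<le> (1 / real p) / (1 - 1 / real p)"
      using p by (intro sum_power_le) auto
    also have "\<dots> = 1 / (real p - 1)" using p by (simp add: field_simps)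
    finally show "0 \<le> (\<Sum>k=1..N. (1 / real p) ^ k) \<and> (\<Sum>k=1..N. (1 / real p) ^ k) \<le> 1 / (real p - 1)"
      by (auto intro: sum_nonneg)
  qed
  finally show ?thesis .
qed

text \<open>Group the \<open>n \<le> z\<close> by their set \<open>R\<close> of prime factors and
  bound each group by \<open>h R\<close>. Then \<open>h R = h (R \<inter> F) * h (R - F)\<close>,
  and summing the first factor over all subsets of \<open>F\<close> gives the product over
  \<open>F\<close>.\<close>

lemma ln_le_sum_squarefree:
  fixes z :: nat and F :: "nat set"
  assumes F: "finite F" "\<And>p. p \<in> F \<Longrightarrow> prime p" and z: "z > 0"
  defines "h \<equiv> \<lambda>I. \<Prod>p\<in>I. 1 / (real p - 1)"
  shows "ln z \<le> (\<Prod>p\<in>F. real p / (real p - 1)) *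
    (\<Sum>I | I \<subseteq> {p. prime p \<and> p \<notin> F \<and> p \<le> z} \<and> \<Prod>I \<le> z. h I)"
proof -
  let ?D = "{I. I \<subseteq> {p. prime p \<and> p \<notin> F \<and> p \<le> z} \<and> \<Prod>I \<le> z}"
  let ?im = "prime_factors ` {1..z}"
  have fin_D: "finite ?D" by (rule finite_subset[of _ "Pow {..z}"]) auto
  have h_nonneg: "h I \<ge> 0" if "\<forall>p\<in>I. prime p" for I
    unfolding h_def using that prime_ge_1_nat by (intro prod_nonneg) fastforce
  have "ln z \<le> ln (real z + 1)" using z by simp
  also have "\<dots> \<le> (\<Sum>n\<in>{1..z}. 1 / real n)" by (rule ln_le_sum_inverse)
  also have "\<dots> = (\<Sum>R\<in>?im. \<Sum>n | n \<in> {1..z} \<and> prime_factors n = R. 1 / real n)"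
    by (rule sum.image_gen) simp
  also have "\<dots> \<le> (\<Sum>R\<in>?im. h R)"
    unfolding h_def by (intro sum_mono sum_inverse_support_le) auto
  also have "\<dots> = (\<Sum>R\<in>?im. case (R \<inter> F, R - F) of (A, I) \<Rightarrow> h A * h I)"
  proof (rule sum.cong[OF refl])
    fix R assume "R \<in> ?im"
    then have "finite R" by auto
    then have "h R = h (R - F) * h (R \<inter> F)"
      unfolding h_def using prod.Int_Diff[of R _ F] by (simp add: mult.commute)
    then show "h R = (case (R \<inter> F, R - F) of (A, I) \<Rightarrow> h A * h I)" by simp
  qed
  also have "\<dots> = (\<Sum>(A, I)\<in>(\<lambda>R. (R \<inter> F, R - F)) ` ?im. h A * h I)"
    by (subst sum.reindex) (auto intro!: inj_onI)
  also have "\<dots> \<le> (\<Sum>(A, I)\<in>Pow F \<times> ?D. h A * h I)"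
  proof (rule sum_mono2)
    show "finite (Pow F \<times> ?D)" using F(1) fin_D by blast
    \<comment> \<open>The product of the prime factors of \<open>n\<close> divides \<open>n\<close>,
      so the part outside \<open>F\<close> has product at most \<open>z\<close>.\<close>
    show "(\<lambda>R. (R \<inter> F, R - F)) ` ?im \<subseteq> Pow F \<times> ?D"
    proof clarify
      fix n assume n: "n \<in> {1..z}"
      have "\<Prod>(prime_factors n) dvd (\<Prod>p\<in>prime_factors n. p ^ multiplicity p n)"
        by (intro prod_dvd_prod dvd_power) (auto simp: prime_factors_multiplicity)
      also have "\<dots> = n" using n by (intro prime_factorization_nat[symmetric]) auto
      finally have "\<Prod>(prime_factors n) dvd n" .
      moreover have "\<Prod>(prime_factors n - F) dvd \<Prod>(prime_factors n)"
        by (rule prod_dvd_prod_subset) auto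
      ultimately have "\<Prod>(prime_factors n - F) dvd n" by (meson dvd_trans)
      then have "\<Prod>(prime_factors n - F) \<le> n" using n by (intro dvd_imp_le) auto
      moreover have "p \<le> z" if "p \<in> prime_factors n" for p
        using that n by (auto simp: in_prime_factors_iff dest!: dvd_imp_le)
      ultimately show "prime_factors n \<inter> F \<in> Pow F \<and> prime_factors n - F \<in> ?D" using n by auto
    qed
    show "0 \<le> (case x of (A, I) \<Rightarrow> h A * h I)"
      if "x \<in> Pow F \<times> ?D - (\<lambda>R. (R \<inter> F, R - F)) ` ?im" for x
    proof -
      from that obtain A I where x: "x = (A, I)" "A \<subseteq> F" "I \<in> ?D" by blast
      then have "h A \<ge> 0" "h I \<ge> 0" using F(2) by (blast intro: h_nonneg)+
      then show ?thesis using x(1) by simp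
    qed
  qed
  also have "\<dots> = (\<Sum>A\<in>Pow F. h A) * (\<Sum>I\<in>?D. h I)"
    by (simp only: sum_product sum.cartesian_product)
  also have "(\<Sum>A\<in>Pow F. h A) = (\<Prod>p\<in>F. 1 / (real p - 1) + 1)"
    unfolding h_def using F(1) by (subst prod_add) auto
  also have "\<dots> = (\<Prod>p\<in>F. real p / (real p - 1))"
  proof (rule prod.cong[OF refl])
    fix p assume "p \<in> F"
    then have "real p > 1" using F(2) prime_gt_1_nat by simp
    then show "1 / (real p - 1) + 1 = real p / (real p - 1)" by (simp add: field_simps)
  qed
  finally show ?thesis .
qed

section \<open>Sieving primes in residue classes\<close>

lemma prime_dvd_prod_primes:
  assumes "finite F" "\<And>p. p \<in> F \<Longrightarrow> prime p" "prime p"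
  shows "p dvd \<Prod>F \<longleftrightarrow> p \<in> (F :: nat set)"
proof
  assume "p dvd \<Prod>F"
  with assms obtain q where "q \<in> F" "p dvd q" by (auto simp: prime_dvd_prod_iff)
  then show "p \<in> F" using assms primes_dvd_imp_eq[of p q] by blast
next
  assume "p \<in> F"
  then show "p dvd \<Prod>F" using assms(1) dvd_prodI[of F p "\<lambda>x. x"] by simp
qed

lemma coprime_prod_primes:
  assumes "finite F" "\<And>p. p \<in> F \<Longrightarrow> prime p" "finite I" "\<And>p. p \<in> I \<Longrightarrow> prime p" "F \<inter> I = {}"
  shows "coprime (\<Prod>F) (\<Prod>I :: nat)"
  using assms by (intro prod_coprime_left prod_coprime_right primes_coprime) auto

lemma prod_primes_dvd_iff:
  assumes "finite F" "\<And>p. p \<in> F \<Longrightarrow> prime p"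
  shows "\<Prod>F dvd (n :: nat) \<longleftrightarrow> (\<forall>p\<in>F. p dvd n)"
  using assms
proof (induction F rule: finite_induct)
  case (insert p F)
  have "coprime p (\<Prod>F)" using coprime_prod_primes[of "{p}" F] insert by auto
  then have "p * \<Prod>F dvd n \<longleftrightarrow> p dvd n \<and> \<Prod>F dvd n"
    by (auto intro: divides_mult dest: dvd_mult_left dvd_mult_right)
  then show ?case using insert by auto
qed simp

text \<open>A prime \<open>q\<close> outside \<open>F\<close> for which \<open>q + 1\<close> is
  coprime to all of \<open>F\<close> lies in one of these classes modulo
  \<open>\<Prod>F\<close>.\<close>

definition twin_classes :: "nat set \<Rightarrow> nat set" where
  "twin_classes F = {a. a < \<Prod>F \<and> (\<forall>p\<in>F. \<not> p dvd a \<and> \<not> p dvd a + 1)}"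

text \<open>Chinese remainder theorem: modulo each \<open>p\<close> the residues 0 and
  \<open>p - 1\<close> are excluded, which leaves \<open>p - 2\<close>.\<close>

lemma card_twin_classes_le:
  assumes "finite F" "\<And>p. p \<in> F \<Longrightarrow> prime p"
  shows "card (twin_classes F) \<le> (\<Prod>p\<in>F. p - 2)"
  using assms
proof (induction F rule: finite_induct)
  case empty
  then show ?case by (simp add: twin_classes_def)
next
  case (insert p F)
  have p: "prime p" and F: "\<And>q. q \<in> F \<Longrightarrow> prime q" using insert by auto
  have cop: "coprime p (\<Prod>F)" using coprime_prod_primes[of "{p}" F] insert by auto
  have F0: "\<Prod>F > 0" using F by (intro prod_pos) (auto simp: prime_gt_0_nat)
  let ?f = "\<lambda>a. (a mod \<Prod>F, a mod p)"
  have "inj_on ?f (twin_classes (insert p F))"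
  proof (rule inj_onI)
    fix a b assume ab: "a \<in> twin_classes (insert p F)" "b \<in> twin_classes (insert p F)" "?f a = ?f b"
    then have "[a = b] (mod p)" "[a = b] (mod \<Prod>F)" by (auto simp: cong_def)
    with cop have "[a = b] (mod (p * \<Prod>F))" by (intro coprime_cong_mult_nat)
    then show "a = b" using ab insert.hyps by (intro cong_less_modulus_unique_nat) (auto simp: twin_classes_def)
  qed
  moreover have "?f ` twin_classes (insert p F) \<subseteq> twin_classes F \<times> {1..<p - 1}"
  proof clarify
    fix a assume a: "a \<in> twin_classes (insert p F)"
    have "q dvd a mod \<Prod>F \<longleftrightarrow> q dvd a" "q dvd a mod \<Prod>F + 1 \<longleftrightarrow> q dvd a + 1" if "q \<in> F" for q
    proof -
      have q: "q dvd \<Prod>F" using that insert.hyps(1) dvd_prodI[of F q "\<lambda>x. x"] by simp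
      then show "q dvd a mod \<Prod>F \<longleftrightarrow> q dvd a" by (rule dvd_mod_iff)
      have "a + 1 = \<Prod>F * (a div \<Prod>F) + (a mod \<Prod>F + 1)" by simp
      then show "q dvd a mod \<Prod>F + 1 \<longleftrightarrow> q dvd a + 1" using q by (metis dvd_add_right_iff dvd_mult2)
    qed
    then have "a mod \<Prod>F \<in> twin_classes F" using a F0 by (auto simp: twin_classes_def)
    moreover have "a mod p \<in> {1..<p - 1}"
    proof -
      have "\<not> p dvd a" "\<not> p dvd a + 1" using a by (auto simp: twin_classes_def)
      then have "a mod p \<noteq> 0" "(a + 1) mod p \<noteq> 0" by (auto simp: dvd_eq_mod_eq_0)
      moreover have "a mod p < p" using p by (simp add: prime_gt_0_nat)
      ultimately show ?thesis by (auto simp: mod_Suc split: if_splits)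
    qed
    ultimately show "a mod \<Prod>F \<in> twin_classes F \<and> a mod p \<in> {1..<p - 1}" by simp
  qed
  moreover have "finite (twin_classes F \<times> {1..<p - 1})" by (auto simp: twin_classes_def)
  ultimately have "card (twin_classes (insert p F)) \<le> card (twin_classes F \<times> {1..<p - 1})"
    by (intro card_inj_on_le)
  also have "\<dots> = card (twin_classes F) * (p - 2)" by (simp add: card_cartesian_product numeral_2_eq_2)
  also have "\<dots> \<le> (\<Prod>p\<in>F. p - 2) * (p - 2)" using insert F by (intro mult_right_mono) auto
  also have "\<dots> = (\<Prod>p\<in>insert p F. p - 2)" using insert.hyps by simp
  finally show ?case .
qed

lemma prod_prime_ratio_nonneg:
  assumes "\<And>p :: nat. p \<in> F \<Longrightarrow> prime p"
  shows "(\<Prod>p\<in>F. real p / (real p - 1)) \<ge> 0"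
proof (rule prod_nonneg)
  fix p assume "p \<in> F"
  then have "real p > 1" using assms prime_gt_1_nat by simp
  then show "real p / (real p - 1) \<ge> 0" by simp
qed

text \<open>Selberg's sieve with the sets of primes outside \<open>F\<close> whose product is at
  most \<open>z\<close>. The lower bound for \<open>S\<close> gives the main term. A set of primes
  is determined by its product, so there are at most \<open>z\<close> sets, each with product at
  most \<open>z\<close>; hence the error \<open>z ^ 4\<close>.\<close>

lemma sieve_progression:
  fixes F :: "nat set" and z N a :: nat
  assumes F: "finite F" "\<And>p. p \<in> F \<Longrightarrow> prime p" and z: "z \<ge> 2"
  shows "real (card {k. k < N \<and> (\<forall>p. prime p \<longrightarrow> p \<notin> F \<longrightarrow> p \<le> z \<longrightarrow> \<not> p dvd a + \<Prod>F * k)})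
    \<le> N * (\<Prod>p\<in>F. real p / (real p - 1)) / ln z + real z ^ 4"
proof -
  define D where "D = {I. I \<subseteq> {p. prime p \<and> p \<notin> F \<and> p \<le> z} \<and> \<Prod>I \<le> z}"
  let ?V = "\<Prod>p\<in>F. real p / (real p - 1)"
  let ?hits = "\<lambda>k p. p dvd a + \<Prod>F * k"
  have DD: "finite I" "prime p" "p \<notin> F" "p \<le> z" "p > 0" if "I \<in> D" "p \<in> I" for I p
    using that by (auto simp: D_def prime_gt_0_nat intro: finite_subset[of I "{..z}"])
  have finD: "finite I" if "I \<in> D" for I
    using that by (auto simp: D_def intro: finite_subset[of I "{..z}"])
  interpret selberg_weights real D
  proof
    show "finite D" unfolding D_def by (rule finite_subset[of _ "Pow {..z}"]) auto
    show "finite I" if "I \<in> D" for I using that by (rule finD)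
    show "J \<in> D" if "I \<in> D" "J \<subseteq> I" for I J
    proof -
      have "\<Prod>J dvd \<Prod>I" using that finD by (intro prod_dvd_prod_subset) auto
      moreover have "\<Prod>I > 0" using DD[OF that(1)] by (intro prod_pos) auto
      ultimately have "\<Prod>J \<le> \<Prod>I" by (rule dvd_imp_le)
      then show ?thesis using that by (auto simp: D_def)
    qed
    show "{} \<in> D" using z by (simp add: D_def)
    show "real p > 1" if "I \<in> D" "p \<in> I" for I p using DD(2)[OF that] prime_gt_1_nat by simp
  qed
  have "real (card {n\<in>{..<N}. \<forall>p\<in>\<Union>D. \<not> ?hits n p}) \<le> real N / S + (real (card D) * real z)\<^sup>2"
  proof (rule sifted_card_le)
    fix I J assume I: "I \<in> D" and J: "J \<in> D"
    have fin: "finite (I \<union> J)" using I J finD by auto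
    have pr: "prime p" "p \<notin> F" if "p \<in> I \<union> J" for p using that DD I J by auto
    have "\<Prod>(I \<union> J) > 0" using pr by (intro prod_pos) (auto simp: prime_gt_0_nat)
    moreover have "coprime (\<Prod>F) (\<Prod>(I \<union> J))"
      using F fin pr by (intro coprime_prod_primes) auto
    moreover have "{n \<in> {..<N}. \<forall>p\<in>I \<union> J. ?hits n p} = {k. k < N \<and> \<Prod>(I \<union> J) dvd a + \<Prod>F * k}"
      using prod_primes_dvd_iff[OF fin pr(1)] by auto
    ultimately show "\<bar>real (card {n \<in> {..<N}. \<forall>p\<in>I \<union> J. ?hits n p}) - real N / (\<Prod>p\<in>I \<union> J. real p)\<bar> \<le> 1"
      using card_progression_multiples[of "\<Prod>F" "\<Prod>(I \<union> J)" N a] by simp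
  next
    fix I assume "I \<in> D"
    then have "real (\<Prod>I) \<le> real z" by (simp only: D_def of_nat_le_iff mem_Collect_eq)
    then show "(\<Prod>p\<in>I. real p) \<le> real z" by simp
  qed simp
  moreover have sifted: "{n\<in>{..<N}. \<forall>p\<in>\<Union>D. \<not> ?hits n p} =
    {k. k < N \<and> (\<forall>p. prime p \<longrightarrow> p \<notin> F \<longrightarrow> p \<le> z \<longrightarrow> \<not> p dvd a + \<Prod>F * k)}"
  proof -
    have "\<Union>D = {p. prime p \<and> p \<notin> F \<and> p \<le> z}"
    proof (intro equalityI subsetI)
      fix p assume "p \<in> {p. prime p \<and> p \<notin> F \<and> p \<le> z}"
      then have "{p} \<in> D" by (simp add: D_def)
      then show "p \<in> \<Union>D" by blast
    qed (use DD in blast)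
    then show ?thesis by auto
  qed
  moreover have "real N / S \<le> N * ?V / ln z"
  proof -
    have "S = (\<Sum>I\<in>D. \<Prod>p\<in>I. 1 / (real p - 1))"
      unfolding S_def g_def by (simp add: prod_dividef)
    then have "ln z \<le> ?V * S" using ln_le_sum_squarefree[OF F, of z] z by (simp add: D_def)
    moreover have "ln (real z) > 0" using z by simp
    ultimately have "1 / S \<le> ?V / ln z" using S_ge_1 by (simp add: field_simps)
    then have "real N * (1 / S) \<le> real N * (?V / ln z)" by (intro mult_left_mono) auto
    then show ?thesis by simp
  qed
  moreover have "(real (card D) * real z)\<^sup>2 \<le> real z ^ 4"
  proof -
    have "inj_on (\<lambda>I. \<Prod>I) D"
    proof (rule inj_onI)
      fix I J assume I: "I \<in> D" and J: "J \<in> D" and eq: "\<Prod>I = \<Prod>J"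
      have "p \<in> I \<longleftrightarrow> p \<in> J" if "prime p" for p
        using prime_dvd_prod_primes[OF finD[OF I] DD(2)[OF I] that]
          prime_dvd_prod_primes[OF finD[OF J] DD(2)[OF J] that] eq by simp
      then show "I = J" using DD(2)[OF I] DD(2)[OF J] by blast
    qed
    moreover have "(\<lambda>I. \<Prod>I) ` D \<subseteq> {1..z}"
    proof clarify
      fix I assume I: "I \<in> D"
      then have "\<Prod>I > 0" using DD[OF I] by (intro prod_pos) auto
      then show "\<Prod>I \<in> {1..z}" using I by (simp add: D_def)
    qed
    ultimately have "card D \<le> card {1..z}" by (intro card_inj_on_le) auto
    then have "(real (card D) * real z)\<^sup>2 \<le> (real z * real z)\<^sup>2"
      by (intro power_mono mult_right_mono) auto
    then show ?thesis by (simp add: power_mult_distrib power_add[symmetric])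
  qed
  ultimately show ?thesis unfolding sifted by linarith
qed

lemma dvd_mod_plus_1_iff: "p dvd m \<Longrightarrow> p dvd a mod m + 1 \<longleftrightarrow> p dvd (a + 1 :: nat)"
proof -
  assume "p dvd m"
  then have "p dvd m * (a div m)" by simp
  moreover have "a + 1 = m * (a div m) + (a mod m + 1)" by simp
  ultimately show ?thesis using dvd_add_right_iff by metis
qed

text \<open>Primes up to \<open>z\<close> are counted trivially. A larger prime \<open>q\<close> has
  no prime factor up to \<open>z\<close>, so \<open>q mod \<Prod>F\<close> is in
  \<open>twin_classes F\<close> and \<open>q div \<Prod>F\<close> survives the sieve in that
  class.\<close>

lemma card_primes_shifted_coprime_le:
  fixes F :: "nat set" and z n :: nat
  assumes F: "finite F" "\<And>p. p \<in> F \<Longrightarrow> prime p" "\<And>p. p \<in> F \<Longrightarrow> p \<le> z" and z: "z \<ge> 2"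
  shows "real (card {q. prime q \<and> q \<le> n \<and> (\<forall>p\<in>F. \<not> p dvd q + 1)}) \<le>
    z + real (card (twin_classes F)) *
      ((n / \<Prod>F + 1) * (\<Prod>p\<in>F. real p / (real p - 1)) / ln z + real z ^ 4)"
proof -
  let ?M = "\<Prod>F"
  let ?V = "\<Prod>p\<in>F. real p / (real p - 1)"
  \<comment> \<open>The additional index covers the last, possibly incomplete, block of length
    \<open>\<Prod>F\<close>.\<close>
  let ?K = "\<lambda>a. {k. k < n div ?M + 1 \<and> (\<forall>p. prime p \<longrightarrow> p \<notin> F \<longrightarrow> p \<le> z \<longrightarrow> \<not> p dvd a + ?M * k)}"
  let ?Q = "{q. prime q \<and> q \<le> n \<and> (\<forall>p\<in>F. \<not> p dvd q + 1)}"
  let ?Q' = "{q\<in>?Q. z < q}"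
  have M0: "?M > 0" using F by (intro prod_pos) (auto simp: prime_gt_0_nat)
  have fin_T: "finite (twin_classes F)" by (simp add: twin_classes_def)
  have "inj_on (\<lambda>q. (q mod ?M, q div ?M)) ?Q'"
    by (rule inj_onI) (metis Pair_inject mult_div_mod_eq)
  moreover have "(\<lambda>q. (q mod ?M, q div ?M)) ` ?Q' \<subseteq> Sigma (twin_classes F) ?K"
  proof (intro subsetI, elim imageE, simp only: mem_Sigma_iff)
    fix q assume q: "q \<in> ?Q'"
    have not_dvd: "\<not> p dvd q" if "prime p" "p \<le> z" for p
      using that q primes_dvd_imp_eq[of p q] by auto
    have dvd: "p dvd ?M" if "p \<in> F" for p
      using that F(1) dvd_prodI[of F p "\<lambda>x. x"] by simp
    have "\<not> p dvd q mod ?M" "\<not> p dvd q mod ?M + 1" if p: "p \<in> F" for p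
      using dvd_mod_iff[OF dvd[OF p], of q] dvd_mod_plus_1_iff[OF dvd[OF p], of q]
        not_dvd F(2,3)[OF p] p q by auto
    then have "q mod ?M \<in> twin_classes F" using M0 by (simp add: twin_classes_def)
    moreover have "q div ?M \<in> ?K (q mod ?M)"
      using q not_dvd by (auto simp: less_Suc_eq_le intro!: div_le_mono)
    ultimately show "q mod ?M \<in> twin_classes F \<and> q div ?M \<in> ?K (q mod ?M)" ..
  qed
  ultimately have "card ?Q' \<le> card (Sigma (twin_classes F) ?K)"
    using fin_T by (intro card_inj_on_le) auto
  also have "\<dots> = (\<Sum>a\<in>twin_classes F. card (?K a))" using fin_T by (intro card_SigmaI) auto
  finally have "real (card ?Q') \<le> real (\<Sum>a\<in>twin_classes F. card (?K a))" by (simp only: of_nat_le_iff)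
  also have "\<dots> = (\<Sum>a\<in>twin_classes F. real (card (?K a)))" by simp
  also have "\<dots> \<le> (\<Sum>a\<in>twin_classes F. (n / ?M + 1) * ?V / ln z + real z ^ 4)"
  proof (rule sum_mono)
    fix a
    have V: "?V \<ge> 0" using F(2) by (rule prod_prime_ratio_nonneg)
    have "real (card (?K a)) \<le> real (n div ?M + 1) * ?V / ln z + real z ^ 4"
      by (rule sieve_progression[OF F(1,2) z])
    also have "real (n div ?M + 1) * ?V / ln z \<le> (n / ?M + 1) * ?V / ln z"
    proof (intro divide_right_mono mult_right_mono)
      have "real (n div ?M) \<le> n / ?M" by (rule of_nat_div_le_of_nat)
      then show "real (n div ?M + 1) \<le> n / ?M + 1" by simp
    qed (use V z in auto)
    finally show "real (card (?K a)) \<le> (n / ?M + 1) * ?V / ln z + real z ^ 4" by simp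
  qed
  finally have Q': "real (card ?Q') \<le> real (card (twin_classes F)) * ((n / ?M + 1) * ?V / ln z + real z ^ 4)"
    by simp
  have "?Q \<subseteq> {1..z} \<union> ?Q'" by (auto simp: Suc_le_eq prime_gt_0_nat)
  then have "card ?Q \<le> card ({1..z} \<union> ?Q')" by (intro card_mono) auto
  also have "\<dots> \<le> z + card ?Q'" using card_Un_le[of "{1..z}" ?Q'] by simp
  finally show ?thesis using Q' by linarith
qed

text \<open>At each \<open>p\<close> the share \<open>(p - 2) / p\<close> of admissible classes
  meets the factor \<open>p / (p - 1)\<close> from the sieve and leaves
  \<open>(p - 2) / (p - 1)\<close>.\<close>

lemma twin_density_le:
  assumes F: "finite F" "\<And>p. p \<in> F \<Longrightarrow> prime p"
  shows "real (card (twin_classes F)) / \<Prod>F * (\<Prod>p\<in>F. real p / (real p - 1)) \<le>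
    (\<Prod>p\<in>F. (real p - 2) / (real p - 1))"
proof -
  have ge2: "p \<ge> 2" if "p \<in> F" for p using F(2)[OF that] by (rule prime_ge_2_nat)
  have "real (card (twin_classes F)) \<le> real (\<Prod>p\<in>F. p - 2)"
    using card_twin_classes_le[OF F] by (simp only: of_nat_le_iff)
  also have "\<dots> = (\<Prod>p\<in>F. real p - 2)"
    unfolding of_nat_prod using ge2 by (intro prod.cong) (auto simp: of_nat_diff)
  finally have "real (card (twin_classes F)) * (1 / \<Prod>F * (\<Prod>p\<in>F. real p / (real p - 1))) \<le>
      (\<Prod>p\<in>F. real p - 2) * (1 / \<Prod>F * (\<Prod>p\<in>F. real p / (real p - 1)))"
    by (intro mult_right_mono mult_nonneg_nonneg prod_prime_ratio_nonneg F(2)) (auto intro: prod_nonneg)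
  also have "\<dots> = (\<Prod>p\<in>F. (real p - 2) * (1 / real p * (real p / (real p - 1))))"
    by (simp only: prod.distrib prod_dividef of_nat_prod prod.neutral_const)
  also have "\<dots> = (\<Prod>p\<in>F. (real p - 2) / (real p - 1))"
  proof (rule prod.cong[OF refl])
    fix p assume "p \<in> F"
    then have "real p \<noteq> 0" using ge2 by fastforce
    then show "(real p - 2) * (1 / real p * (real p / (real p - 1))) = (real p - 2) / (real p - 1)"
      by simp
  qed
  finally show ?thesis by simp
qed

section \<open>Chebyshev's lower bound\<close>

text \<open>
  The entries \<open>1 / ((n + 1) \<cdot> (n choose m))\<close> of Leibniz' harmonic triangle are differences of
  entries above them, so a common multiple of the denominators \<open>1, \<dots>, N\<close> of the border
  clears all of them.
\<close>

lemma harmonic_triangle_step: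
  assumes "m \<le> n"
  shows "1 / (real (n + 1) * real (n choose m)) =
    1 / (real (n + 2) * real (Suc n choose m)) + 1 / (real (n + 2) * real (Suc n choose Suc m))"
proof -
  define b where "b = real (n choose m)"
  have b: "b > 0" using assms by (simp add: b_def)
  have "(Suc n choose Suc m) * Suc m = Suc n * (n choose m)" by (rule Suc_times_binomial_eq[symmetric])
  then have "real ((Suc n choose Suc m) * Suc m) = real (Suc n * (n choose m))" by (rule arg_cong)
  then have 1: "real (Suc n choose Suc m) = (real n + 1) * b / (real m + 1)"
    by (simp add: b_def field_simps)
  have "(Suc n - m) * (Suc n choose m) = Suc n * (n choose m)"
    using binomial_absorb_comp[of "Suc n" m] by simp
  then have "real ((Suc n - m) * (Suc n choose m)) = real (Suc n * (n choose m))" by (rule arg_cong)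
  then have 2: "real (Suc n choose m) = (real n + 1) * b / (real n + 1 - real m)"
    using assms by (simp add: b_def field_simps of_nat_diff)
  have num: "(real n + 1 - real m) + (real m + 1) = 2 + real n" by simp
  let ?c = "(2 + real n) * ((real n + 1) * b)"
  have "1 / (real (n + 2) * real (Suc n choose m)) + 1 / (real (n + 2) * real (Suc n choose Suc m)) =
    (real n + 1 - real m) / ?c + (real m + 1) / ?c"
    unfolding 1 2 by (simp add: mult.assoc)
  also have "\<dots> = (2 + real n) / ?c"
    by (simp only: add_divide_distrib[symmetric] num)
  also have "\<dots> = 1 / ((real n + 1) * b)"
    using nonzero_mult_divide_mult_cancel_left[of "2 + real n" 1 "(real n + 1) * b"] by simp
  finally show ?thesis by (simp add: b_def add.commute)
qed

lemma common_multiple_harmonic_triangle: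
  assumes D: "\<And>k. 0 < k \<Longrightarrow> k \<le> N \<Longrightarrow> k dvd D"
  shows "m \<le> n \<Longrightarrow> n < N \<Longrightarrow> real D / (real (n + 1) * real (n choose m)) \<in> \<int>"
proof (induction m arbitrary: n)
  case 0
  then have "n + 1 dvd D" by (intro D) auto
  then obtain k where "D = (n + 1) * k" by (elim dvdE)
  then have "real D = real (n + 1) * real k" by (simp only: of_nat_mult)
  then have "real D / (real (n + 1) * real (n choose 0)) = real k" by (simp add: field_simps)
  then show ?case by simp
next
  case (Suc m)
  then obtain l where n: "n = Suc l" by (cases n) auto
  have "real D / (real (n + 1) * real (n choose Suc m)) =
      real D / (real (l + 1) * real (l choose m)) - real D / (real (n + 1) * real (n choose m))"
    using harmonic_triangle_step[of m l] Suc.prems n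
    by (simp add: divide_inverse algebra_simps)
  also have "\<dots> \<in> \<int>" using Suc.prems n by (intro Ints_diff Suc.IH) auto
  finally show ?case .
qed

text \<open>Clearing the middle entry of the triangle's row \<open>2 * m\<close> makes
  \<open>D / ((2 * m + 1) * (2 * m choose m))\<close> a positive integer, hence at least 1, and the
  central binomial coefficient is at least \<open>4 ^ m / (2 * m)\<close>.\<close>

lemma common_multiple_ge:
  assumes D: "\<And>k. 0 < k \<Longrightarrow> k \<le> 2 * m + 1 \<Longrightarrow> k dvd D" and "D > 0"
  shows "4 ^ m \<le> D"
proof (cases "m = 0")
  case True
  then show ?thesis using \<open>D > 0\<close> by simp
next
  case False
  let ?b = "real (2 * m choose m)"
  have b: "?b > 0" by simp
  have pos: "real (2 * m + 1) * ?b > 0" by (intro mult_pos_pos b) simp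
  have "real D / (real (2 * m + 1) * ?b) \<in> \<int>"
    by (rule common_multiple_harmonic_triangle[OF D]) auto
  moreover have "real D / (real (2 * m + 1) * ?b) > 0"
    by (rule divide_pos_pos[OF _ pos]) (simp add: assms(2))
  ultimately have "real D / (real (2 * m + 1) * ?b) \<ge> 1"
    using Ints_nonzero_abs_ge1[of "real D / (real (2 * m + 1) * ?b)"] by linarith
  then have ge: "real (2 * m + 1) * ?b \<le> real D" using pos by (simp only: le_divide_eq_1_pos)
  have "4 ^ m / (2 * real m) \<le> ?b" using False by (intro central_binomial_lower_bound) simp
  then have "4 ^ m \<le> (2 * real m) * ?b" using False by (simp add: field_simps)
  also have "\<dots> \<le> real (2 * m + 1) * ?b" by (intro mult_right_mono) auto
  also note ge
  finally have "real (4 ^ m) \<le> real D" by simp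
  then show ?thesis by (simp only: of_nat_le_iff)
qed

lemma prime_pi_of_nat: "prime_pi (real n) = card {p. prime p \<and> p \<le> n}"
  by (simp add: prime_pi_def)

text \<open>The witness is the least common multiple of \<open>1, ..., N\<close>: for each prime up
  to \<open>N\<close> take its largest power that is at most \<open>N\<close>.\<close>

lemma ex_common_multiple_le:
  fixes N :: nat
  shows "\<exists>D. D > 0 \<and> (\<forall>k. 0 < k \<longrightarrow> k \<le> N \<longrightarrow> k dvd D) \<and> D \<le> N ^ prime_pi N"
proof (cases "N = 0")
  case True
  moreover have none: "{p::nat. prime p \<and> p \<le> 0} = {}" by auto
  ultimately have "prime_pi N = 0" using prime_pi_of_nat[of N] by (simp only: card.empty)
  then show ?thesis using True by (intro exI[of _ 1]) simp
next
  case False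
  define e where "e p = Max {j. p ^ j \<le> N}" for p :: nat
  have e: "p ^ e p \<le> N" "p ^ j \<le> N \<Longrightarrow> j \<le> e p" if "prime p" for p j
  proof -
    have "{j. p ^ j \<le> N} \<subseteq> {..N}"
    proof clarify
      fix j assume "p ^ j \<le> N"
      moreover have "j < 2 ^ j" by (rule less_exp)
      moreover have "(2::nat) ^ j \<le> p ^ j" using prime_ge_2_nat[OF that] by (intro power_mono) auto
      ultimately show "j \<le> N" by linarith
    qed
    then have fin: "finite {j. p ^ j \<le> N}" by (rule finite_subset) simp
    moreover have "0 \<in> {j. p ^ j \<le> N}" using False by simp
    ultimately have "e p \<in> {j. p ^ j \<le> N}" unfolding e_def by (intro Max_in) blast+
    then show "p ^ e p \<le> N" by simp
    show "j \<le> e p" if "p ^ j \<le> N" using fin that unfolding e_def by (intro Max_ge) auto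
  qed
  let ?P = "{p. prime p \<and> p \<le> N}"
  have fin: "finite ?P" by simp
  define D where "D = (\<Prod>p\<in>?P. p ^ e p)"
  have "D > 0" unfolding D_def by (intro prod_pos) (auto simp: prime_gt_0_nat)
  moreover have "k dvd D" if k: "0 < k" "k \<le> N" for k
  proof -
    have "k = (\<Prod>p\<in>prime_factors k. p ^ multiplicity p k)"
      using k by (intro prime_factorization_nat)
    also have "\<dots> dvd (\<Prod>p\<in>prime_factors k. p ^ e p)"
    proof (rule prod_dvd_prod)
      fix p assume p: "p \<in> prime_factors k"
      have "p ^ multiplicity p k \<le> k" using k by (intro dvd_imp_le multiplicity_dvd) auto
      then show "p ^ multiplicity p k dvd p ^ e p"
        using k e(2)[of p "multiplicity p k"] p by (intro le_imp_power_dvd) auto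
    qed
    also have "\<dots> dvd D" unfolding D_def
      using k by (intro prod_dvd_prod_subset fin) (auto simp: in_prime_factors_iff dest!: dvd_imp_le)
    finally show ?thesis .
  qed
  moreover have "D \<le> (\<Prod>p\<in>?P. N)" unfolding D_def using e(1) by (intro prod_mono) auto
  then have "D \<le> N ^ prime_pi N" by (simp add: prime_pi_of_nat)
  ultimately show ?thesis by blast
qed

text \<open>Compare the bounds \<open>4 ^ m\<close> and \<open>n ^ prime_pi n\<close> for a common
  multiple of \<open>1, ..., 2 * m + 1\<close> and take logarithms.\<close>

lemma prime_pi_lower_bound:
  fixes n :: nat
  assumes "n \<ge> 4"
  shows "n / (4 * ln n) \<le> prime_pi n"
proof -
  \<comment> \<open>The largest \<open>m\<close> with \<open>2 * m + 1 \<le> n\<close>.\<close>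
  define m where "m = (n - 1) div 2"
  have m: "2 * m + 1 \<le> n" "n \<le> 2 * m + 2" using assms unfolding m_def by presburger+
  from ex_common_multiple_le[of "2 * m + 1"] obtain D where D: "D > 0"
    "\<And>k. 0 < k \<Longrightarrow> k \<le> 2 * m + 1 \<Longrightarrow> k dvd D" "D \<le> (2 * m + 1) ^ prime_pi (2 * m + 1)" by blast
  have "4 ^ m \<le> D" by (rule common_multiple_ge) (use D in auto)
  also have "\<dots> \<le> n ^ prime_pi (2 * m + 1)" using D(3) power_mono[OF m(1)] by (meson le_trans zero_le)
  also have "\<dots> \<le> n ^ prime_pi n"
  proof (rule power_increasing)
    show "prime_pi (2 * m + 1) \<le> prime_pi n"
      unfolding prime_pi_of_nat using m(1) by (intro card_mono) auto
  qed (use assms in auto)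
  finally have "real (4 ^ m) \<le> real (n ^ prime_pi n)" by (simp only: of_nat_le_iff)
  then have "(4::real) ^ m \<le> real n ^ prime_pi n" by simp
  then have "ln ((4::real) ^ m) \<le> ln (real n ^ prime_pi n)" using assms by (subst ln_le_cancel_iff) auto
  then have main: "m * ln 4 \<le> prime_pi n * ln n" using assms by (simp add: ln_realpow)
  \<comment> \<open>This yields \<open>ln 4 \<ge> 1\<close>.\<close>
  have "ln (1 / 2 :: real) \<le> 1 / 2 - 1" by (rule ln_le_minus_one) simp
  then have "ln (2::real) \<ge> 1 / 2" by (simp add: ln_div)
  moreover have "ln (4::real) = 2 * ln 2" using ln_realpow[of 2 2] by simp
  ultimately have "real m * 1 \<le> m * ln 4" by (intro mult_left_mono) auto
  moreover have "real n / 4 \<le> m" using m assms by linarith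
  ultimately have "real n / 4 \<le> prime_pi n * ln n" using main by linarith
  moreover have "ln (real n) > 0" using assms by simp
  ultimately show ?thesis by (simp add: field_simps)
qed

section \<open>Relative density\<close>

text \<open>The sieve is run with \<open>z\<close> about \<open>n powr (1/8)\<close>: then
  \<open>z ^ 4\<close> is at most \<open>n powr (1/2)\<close>, and
  \<open>ln z \<ge> ln n / 16\<close>, which is the source of the 16. As \<open>F\<close> is fixed,
  all error terms are of smaller order than \<open>n / ln n\<close>.\<close>

lemma eventually_card_primes_shifted_coprime_le:
  fixes F :: "nat set" and \<delta> :: real
  assumes F: "finite F" "\<And>p. p \<in> F \<Longrightarrow> prime p" and \<delta>: "\<delta> > 0"
  shows "eventually (\<lambda>n. real (card {q. prime q \<and> q \<le> n \<and> (\<forall>p\<in>F. \<not> p dvd q + 1)}) \<le>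
    (16 * (\<Prod>p\<in>F. (real p - 2) / (real p - 1)) + \<delta>) * (n / ln n)) sequentially"
proof -
  define V where "V = (\<Prod>p\<in>F. real p / (real p - 1))"
  define W where "W = (\<Prod>p\<in>F. (real p - 2) / (real p - 1))"
  define T where "T = real (card (twin_classes F))"
  \<comment> \<open>\<open>K \<le> z\<close> will ensure \<open>z \<ge> 2\<close> and
    \<open>p \<le> z\<close> for all \<open>p\<close> in \<open>F\<close>.\<close>
  define K where "K = real (\<Sum>F + 2)"
  have V: "V \<ge> 0" unfolding V_def using F(2) by (rule prod_prime_ratio_nonneg)
  have T: "T \<ge> 0" by (simp add: T_def)
  have M0: "\<Prod>F > 0" using F by (intro prod_pos) (auto simp: prime_gt_0_nat)
  have W: "T / real (\<Prod>F) * V \<le> W" unfolding T_def V_def W_def by (rule twin_density_le[OF F])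
  \<comment> \<open>These are the errors divided by \<open>n / ln n\<close>, up to constants: the
    primes up to \<open>z\<close>, the incomplete block, and the \<open>z ^ 4\<close> of each
    class.\<close>
  have lims: "((\<lambda>x::real. x powr (1/8) * ln x / x) \<longlongrightarrow> 0) at_top"
    "((\<lambda>x::real. 1 / x) \<longlongrightarrow> 0) at_top" "((\<lambda>x::real. x powr (1/2) * ln x / x) \<longlongrightarrow> 0) at_top"
    by real_asymp+
  have "((\<lambda>x::real. x powr (1/8) * ln x / x + 16 * T * V * (1 / x) + T * (x powr (1/2) * ln x / x))
    \<longlongrightarrow> 0 + 16 * T * V * 0 + T * 0) at_top"
    by (intro tendsto_intros lims)
  then have "eventually (\<lambda>x::real. x powr (1/8) * ln x / x + 16 * T * V * (1 / x) +
      T * (x powr (1/2) * ln x / x) < \<delta>) at_top"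
    using \<delta> by (intro order_tendstoD) auto
  \<comment> \<open>Room for rounding \<open>x powr (1/8)\<close> down to an integer: the result is
    still at least \<open>x powr (1/16)\<close>.\<close>
  moreover have "eventually (\<lambda>x::real. x powr (1/16) \<le> x powr (1/8) - 1) at_top" by real_asymp
  moreover have "filterlim (\<lambda>x::real. x powr (1/16)) at_top at_top" by real_asymp
  then have "eventually (\<lambda>x::real. K \<le> x powr (1/16)) at_top" by (simp add: filterlim_at_top)
  ultimately have "eventually (\<lambda>x::real. x > 1 \<and> K \<le> x powr (1/16) \<and> x powr (1/16) \<le> x powr (1/8) - 1 \<and>
      x powr (1/8) * ln x / x + 16 * T * V * (1 / x) + T * (x powr (1/2) * ln x / x) < \<delta>) at_top"
    using eventually_gt_at_top[of "1::real"] by eventually_elim auto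
  then have "eventually (\<lambda>n. real n > 1 \<and> K \<le> real n powr (1/16) \<and> real n powr (1/16) \<le> real n powr (1/8) - 1 \<and>
      real n powr (1/8) * ln (real n) / real n + 16 * T * V * (1 / real n) +
      T * (real n powr (1/2) * ln (real n) / real n) < \<delta>) sequentially"
    by (rule eventually_compose_filterlim[OF _ filterlim_real_sequentially])
  then show ?thesis
  proof eventually_elim
    case (elim n)
    define x where "x = real n"
    define z where "z = nat \<lfloor>x powr (1/8)\<rfloor>"
    have x: "x > 1" "K \<le> x powr (1/16)" "x powr (1/16) \<le> x powr (1/8) - 1"
      and small: "x powr (1/8) * ln x / x + 16 * T * V * (1 / x) + T * (x powr (1/2) * ln x / x) < \<delta>"
      using elim by (auto simp: x_def)
    have lnx: "ln x > 0" using x by simp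
    have z_le: "real z \<le> x powr (1/8)" unfolding z_def by (rule of_nat_floor) simp
    have "x powr (1/8) - 1 \<le> real z" unfolding z_def by linarith
    then have z_ge: "x powr (1/16) \<le> real z" using x by linarith
    then have Kz: "K \<le> real z" using x by linarith
    then have "\<Sum>F + 2 \<le> z" unfolding K_def of_nat_le_iff .
    moreover have "p \<le> \<Sum>F" if "p \<in> F" for p
      using member_le_sum[of p F "\<lambda>x. x"] that F(1) by simp
    ultimately have z2: "z \<ge> 2" and Fz: "\<And>p. p \<in> F \<Longrightarrow> p \<le> z" by force+
    have "ln (x powr (1/16)) \<le> ln (real z)" using z_ge x z2 by (subst ln_le_cancel_iff) auto
    then have lnz: "ln x / 16 \<le> ln (real z)" using x by (simp add: ln_powr)
    have "real z ^ 4 \<le> (x powr (1/8)) ^ 4" using z_le by (intro power_mono) auto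
    also have "\<dots> = x powr (1/2)" using x by (simp add: powr_realpow[symmetric] powr_powr)
    finally have z4: "real z ^ 4 \<le> x powr (1/2)" .
    have "real (card {q. prime q \<and> q \<le> n \<and> (\<forall>p\<in>F. \<not> p dvd q + 1)}) \<le>
      z + T * ((x / \<Prod>F + 1) * V / ln z + real z ^ 4)"
      unfolding T_def V_def x_def by (rule card_primes_shifted_coprime_le[OF F Fz z2])
    also have "\<dots> = z + (T / real (\<Prod>F) * V * x + T * V) * (1 / ln z) + T * real z ^ 4"
      by (simp add: algebra_simps add_divide_distrib)
    also have "\<dots> \<le> x powr (1/8) + (W * x + T * V) * (16 / ln x) + T * x powr (1/2)"
    proof -
      have "(T / real (\<Prod>F) * V * x + T * V) * (1 / ln z) \<le> (W * x + T * V) * (16 / ln x)"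
      proof (rule mult_mono)
        show "T / real (\<Prod>F) * V * x + T * V \<le> W * x + T * V"
          using W x by (intro add_right_mono mult_right_mono) auto
        show "1 / ln (real z) \<le> 16 / ln x" using lnz lnx by (simp add: field_simps)
        have "0 \<le> T / real (\<Prod>F) * V" using T V by (intro mult_nonneg_nonneg divide_nonneg_nonneg of_nat_0_le_iff)
        then show "0 \<le> W * x + T * V" using W T V x by (intro add_nonneg_nonneg mult_nonneg_nonneg) auto
        show "0 \<le> 1 / ln (real z)" using z2 by simp
      qed
      moreover have "T * real z ^ 4 \<le> T * x powr (1/2)" using z4 T by (rule mult_left_mono)
      ultimately show ?thesis using z_le by linarith
    qed
    also have "\<dots> = (16 * W + (x powr (1/8) * ln x / x + 16 * T * V * (1 / x) + T * (x powr (1/2) * ln x / x))) * (x / ln x)"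
      using x lnx by (simp add: field_simps)
    also have "\<dots> \<le> (16 * W + \<delta>) * (x / ln x)"
      using small x lnx by (intro mult_right_mono) auto
    finally show ?case by (simp add: W_def x_def)
  qed
qed

text \<open>Each factor \<open>1 - 1 / (p - 1)\<close> is at most \<open>exp (- (1 / p))\<close>,
  and the divergent sum of reciprocals makes the product arbitrarily small even without the finitely
  many primes in \<open>G\<close>.\<close>

lemma ex_sparse_primes5:
  assumes "finite G" "\<delta> > 0"
  shows "\<exists>F. finite F \<and> F \<subseteq> primes5 \<and> F \<inter> G = {} \<and> (\<Prod>p\<in>F. (real p - 2) / (real p - 1)) < \<delta>"
proof -
  \<comment> \<open>The threshold includes all that \<open>G\<close> can take away, so the
    reciprocals over \<open>F\<close> alone exceed \<open>- ln \<delta>\<close>.\<close>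
  define B where "B = (\<Sum>p\<in>G. 1 / real p) - ln \<delta>"
  let ?f = "\<lambda>p. if p \<in> primes5 then 1 / real p else 0"
  have "\<exists>n. \<not> sum ?f {..<n} \<le> B"
  proof (rule ccontr)
    assume "\<nexists>n. \<not> sum ?f {..<n} \<le> B"
    then have "summable ?f" by (intro summableI_nonneg_bounded[of ?f B]) auto
    then show False using not_summable_primes5 by (rule notE[rotated])
  qed
  then obtain n where n: "sum ?f {..<n} > B" by (auto simp: not_le)
  define F where "F = {p \<in> primes5. p < n} - G"
  have fin: "finite F" by (simp add: F_def)
  have "sum ?f {..<n} = (\<Sum>p | p \<in> primes5 \<and> p < n. 1 / real p)"
    by (intro sum.mono_neutral_cong_right) auto
  also have "\<dots> \<le> (\<Sum>p\<in>F \<union> G. 1 / real p)"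
    using assms(1) fin by (intro sum_mono2) (auto simp: F_def)
  also have "\<dots> \<le> (\<Sum>p\<in>F. 1 / real p) + (\<Sum>p\<in>G. 1 / real p)"
    using assms(1) fin by (subst sum.union_inter[symmetric]) (auto intro!: sum_nonneg)
  finally have large: "- ln \<delta> < (\<Sum>p\<in>F. 1 / real p)" using n by (simp add: B_def)
  have "(\<Prod>p\<in>F. (real p - 2) / (real p - 1)) \<le> (\<Prod>p\<in>F. exp (- (1 / real p)))"
  proof (rule prod_mono)
    fix p assume "p \<in> F"
    then have p: "real p \<ge> 2" using prime_ge_2_nat by (auto simp: F_def)
    have "(real p - 2) / (real p - 1) = 1 + - (1 / (real p - 1))" using p by (simp add: field_simps)
    also have "\<dots> \<le> 1 + - (1 / real p)" using p by (simp add: field_simps)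
    also have "\<dots> \<le> exp (- (1 / real p))" by (rule exp_ge_add_one_self)
    finally show "0 \<le> (real p - 2) / (real p - 1) \<and> (real p - 2) / (real p - 1) \<le> exp (- (1 / real p))"
      using p by simp
  qed
  also have "\<dots> = exp (- (\<Sum>p\<in>F. 1 / real p))" using fin by (simp add: exp_sum sum_negf[symmetric])
  also have "\<dots> < exp (ln \<delta>)" using large by simp
  also have "\<dots> = \<delta>" using assms by simp
  finally show ?thesis using fin by (intro exI[of _ F]) (auto simp: F_def)
qed

text \<open>Repeated choice, each time avoiding the union of the sets chosen before.\<close>

lemma ex_disjoint_sparse_primes5:
  assumes "\<delta> > 0"
  shows "\<exists>Fs. (\<forall>i<k. finite (Fs i) \<and> Fs i \<subseteq> primes5 \<and> (\<Prod>p\<in>Fs i. (real p - 2) / (real p - 1)) < \<delta>) \<and>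
    disjoint_family_on Fs {..<k :: nat}"
proof (induction k)
  case 0
  show ?case by (simp add: disjoint_family_on_def)
next
  case (Suc k)
  then obtain Fs where Fs: "\<forall>i<k. finite (Fs i) \<and> Fs i \<subseteq> primes5 \<and> (\<Prod>p\<in>Fs i. (real p - 2) / (real p - 1)) < \<delta>"
    "disjoint_family_on Fs {..<k}" by blast
  have "finite (\<Union>i<k. Fs i)" using Fs(1) by auto
  from ex_sparse_primes5[OF this assms] obtain F where
    F: "finite F" "F \<subseteq> primes5" "F \<inter> (\<Union>i<k. Fs i) = {}" "(\<Prod>p\<in>F. (real p - 2) / (real p - 1)) < \<delta>" by blast
  show ?case
  proof (intro exI[of _ "Fs(k := F)"] conjI allI impI)
    fix i assume "i < Suc k"
    then have i: "i = k \<or> i \<noteq> k \<and> i < k" by auto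
    show "finite ((Fs(k := F)) i)" "(Fs(k := F)) i \<subseteq> primes5"
      "(\<Prod>p\<in>(Fs(k := F)) i. (real p - 2) / (real p - 1)) < \<delta>"
      using i Fs(1) F by auto
  next
    show "disjoint_family_on (Fs(k := F)) {..<Suc k}"
      unfolding disjoint_family_on_def
    proof (intro ballI impI)
      fix i j assume ij: "i \<in> {..<Suc k}" "j \<in> {..<Suc k}" "i \<noteq> j"
      then consider "i = k" "j < k" | "j = k" "i < k" | "i < k" "j < k" by force
      then show "(Fs(k := F)) i \<inter> (Fs(k := F)) j = {}"
        using F(3) Fs(2) ij by cases (auto simp: disjoint_family_on_def)
    qed
  qed
qed

text \<open>If \<open>q + 1\<close> has a divisor in each of \<open>k\<close> disjoint sets, it has
  \<open>k\<close> distinct prime factors congruent to 5 modulo 6, and \<open>psi_eta q\<close>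
  exceeds \<open>c + 1\<close>. So an odd exceptional prime misses one of the sets, and the sieve
  bounds are added over the \<open>k\<close> sets; the summand 1 is for the prime 2.\<close>

lemma eventually_card_not_psi_T_le:
  assumes "\<delta> > 0"
  shows "eventually (\<lambda>n. real (card {q. prime q \<and> q \<le> n \<and> q \<notin> psi_T c}) \<le> 1 + \<delta> * (n / ln n)) sequentially"
proof -
  obtain k0 :: nat where k0: "c + 1 < real k0 * eta_gain" using reals_Archimedean3[OF eta_gain_pos] by blast
  \<comment> \<open>Positive whatever \<open>c\<close> is, since \<open>d\<close> divides by
    \<open>k\<close>.\<close>
  define k where "k = Suc k0"
  have k: "c + 1 < real k * eta_gain" using k0 eta_gain_pos by (simp add: k_def algebra_simps)
  \<comment> \<open>Each set costs \<open>16 * d\<close> for its small product and \<open>d\<close>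
    for the sieve errors; over \<open>k\<close> sets this adds up to
    \<open>\<delta>\<close>.\<close>
  define d where "d = \<delta> / (17 * real k)"
  have d: "d > 0" using assms by (simp add: d_def k_def)
  have "real k > 0" by (simp add: k_def)
  then have kd: "real k * (17 * d) = \<delta>" by (simp add: d_def)
  obtain Fs where Fs0: "\<forall>i<k. finite (Fs i) \<and> Fs i \<subseteq> primes5 \<and> (\<Prod>p\<in>Fs i. (real p - 2) / (real p - 1)) < d"
    and disj: "disjoint_family_on Fs {..<k}"
    using ex_disjoint_sparse_primes5[OF d, of k] by blast
  have Fs: "finite (Fs i)" "Fs i \<subseteq> primes5" "(\<Prod>p\<in>Fs i. (real p - 2) / (real p - 1)) < d" if "i < k" for i
    using Fs0 that by blast+
  let ?E = "\<lambda>n i. {q. prime q \<and> q \<le> n \<and> (\<forall>p\<in>Fs i. \<not> p dvd q + 1)}"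
  have in_T: "q \<in> psi_T c" if q: "prime q" "q \<noteq> 2" "\<forall>i<k. \<exists>p\<in>Fs i. p dvd q + 1" for q
  proof -
    have odd: "odd q" using q primes_dvd_imp_eq two_is_prime_nat by blast
    obtain f where f: "\<And>i. i < k \<Longrightarrow> f i \<in> Fs i" "\<And>i. i < k \<Longrightarrow> f i dvd q + 1" using q(3) by metis
    have "inj_on f {..<k}"
      using f(1) disj unfolding inj_on_def disjoint_family_on_def by (metis disjoint_iff lessThan_iff)
    then have "card (f ` {..<k}) = k" by (simp add: card_image)
    moreover have "psi_eta q \<ge> card (f ` {..<k}) * eta_gain"
      using f Fs(2) by (intro psi_eta_ge q(1) odd) blast+
    ultimately show ?thesis using k q(1) odd by (simp add: psi_T_def)
  qed
  have "eventually (\<lambda>n. \<forall>i\<in>{..<k}. real (card (?E n i)) \<le>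
     (16 * (\<Prod>p\<in>Fs i. (real p - 2) / (real p - 1)) + d) * (n / ln n)) sequentially"
  proof (intro eventually_ball_finite ballI)
    fix i assume "i \<in> {..<k}"
    then show "eventually (\<lambda>n. real (card (?E n i)) \<le>
     (16 * (\<Prod>p\<in>Fs i. (real p - 2) / (real p - 1)) + d) * (n / ln n)) sequentially"
      using Fs d by (intro eventually_card_primes_shifted_coprime_le) auto
  qed simp
  then show ?thesis using eventually_ge_at_top[of 2]
  proof eventually_elim
    case (elim n)
    have "{q. prime q \<and> q \<le> n \<and> q \<notin> psi_T c} \<subseteq> {2} \<union> (\<Union>i\<in>{..<k}. ?E n i)"
    proof
      fix q assume q: "q \<in> {q. prime q \<and> q \<le> n \<and> q \<notin> psi_T c}"
      show "q \<in> {2} \<union> (\<Union>i\<in>{..<k}. ?E n i)"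
      proof (cases "q = 2")
        case False
        with q in_T[of q] obtain i where "i < k" "\<forall>p\<in>Fs i. \<not> p dvd q + 1" by auto
        with q have "i \<in> {..<k}" "q \<in> ?E n i" by simp_all
        then show ?thesis by blast
      qed simp
    qed
    then have "card {q. prime q \<and> q \<le> n \<and> q \<notin> psi_T c} \<le> card ({2} \<union> (\<Union>i\<in>{..<k}. ?E n i))"
      by (intro card_mono) auto
    also have "\<dots> \<le> card {2::nat} + card (\<Union>i\<in>{..<k}. ?E n i)" by (rule card_Un_le)
    also have "card (\<Union>i\<in>{..<k}. ?E n i) \<le> (\<Sum>i<k. card (?E n i))" by (rule card_UN_le) simp
    finally have "real (card {q. prime q \<and> q \<le> n \<and> q \<notin> psi_T c}) \<le> real (1 + (\<Sum>i<k. card (?E n i)))"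
      by (simp only: of_nat_le_iff card.empty card_insert_disjoint finite.emptyI empty_iff not_False_eq_True One_nat_def)
    also have "\<dots> = 1 + (\<Sum>i<k. real (card (?E n i)))" by simp
    also have "(\<Sum>i<k. real (card (?E n i))) \<le> (\<Sum>i<k. (17 * d) * (n / ln n))"
    proof (rule sum_mono)
      fix i assume i: "i \<in> {..<k}"
      have "real (card (?E n i)) \<le> (16 * (\<Prod>p\<in>Fs i. (real p - 2) / (real p - 1)) + d) * (n / ln n)"
        using elim(1) i by blast
      also have "\<dots> \<le> (17 * d) * (n / ln n)"
        using Fs(3)[of i] i elim(2) by (intro mult_right_mono) auto
      finally show "real (card (?E n i)) \<le> (17 * d) * (n / ln n)" .
    qed
    also have "\<dots> = (real k * (17 * d)) * (n / ln n)" by simp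
    finally show ?case unfolding kd by simp
  qed
qed

section \<open>From exceptional primes to the limit\<close>

lemma psi_b_plus_exceptions:
  "psi_b c (real n) + card {q. prime q \<and> q \<le> n \<and> q \<notin> psi_T c} = prime_pi (real n)"
proof -
  have "{q. prime q \<and> q \<le> n} = {q \<in> psi_T c. q \<le> n} \<union> {q. prime q \<and> q \<le> n \<and> q \<notin> psi_T c}"
    by (auto simp: psi_T_def)
  then have "card {q. prime q \<and> q \<le> n} = card {q \<in> psi_T c. q \<le> n} + card {q. prime q \<and> q \<le> n \<and> q \<notin> psi_T c}"
    by (simp add: card_Un_disjoint disjoint_iff)
  then show ?thesis by (simp add: prime_pi_of_nat psi_b_def)
qed

text \<open>The ratio differs from 1 by the share of exceptional primes. Their number is eventually
  below \<open>e / 4 * (n / ln n)\<close>, and Chebyshev's bound puts at least a quarter of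
  \<open>n / ln n\<close> in the denominator.\<close>

lemma psi_b_ratio_tendsto_sequentially:
  "(\<lambda>n. real (psi_b c (real n)) / real (prime_pi (real n))) \<longlonglongrightarrow> 1"
proof (rule tendstoI)
  fix e :: real assume e: "e > 0"
  have "((\<lambda>x::real. ln x / x) \<longlongrightarrow> 0) at_top" by real_asymp
  then have "eventually (\<lambda>x::real. ln x / x < e / 8) at_top" using e by (intro order_tendstoD) auto
  then have "eventually (\<lambda>n. ln (real n) / real n < e / 8) sequentially"
    by (rule eventually_compose_filterlim[OF _ filterlim_real_sequentially])
  \<comment> \<open>Half of \<open>e / 4\<close> goes to the bound for the odd exceptional primes;
    the other half absorbs the summand 1.\<close>
  moreover have "e / 8 > 0" using e by simp
  note eventually_card_not_psi_T_le[OF this, of c]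
  ultimately show "eventually (\<lambda>n. dist (real (psi_b c (real n)) / real (prime_pi (real n))) 1 < e) sequentially"
    using eventually_ge_at_top[of 4]
  proof eventually_elim
    case (elim n)
    let ?p = "real (prime_pi (real n))" and ?r = "real (card {q. prime q \<and> q \<le> n \<and> q \<notin> psi_T c})"
    have y: "real n / ln (real n) > 0" using elim(3) by simp
    have pi: "real n / (4 * ln (real n)) \<le> ?p" using elim(3) by (rule prime_pi_lower_bound)
    then have p: "?p > 0" using y by (simp add: field_simps)
    have b: "real (psi_b c (real n)) = ?p - ?r" using psi_b_plus_exceptions[of c n] by linarith
    have "real (psi_b c (real n)) / ?p - 1 = - (?r / ?p)"
      unfolding b using p by (simp add: diff_divide_distrib)
    then have "dist (real (psi_b c (real n)) / ?p) 1 = ?r / ?p" by (simp add: dist_real_def)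
    also have "\<dots> < e"
    proof -
      have "1 < e / 8 * (real n / ln (real n))" using elim(1,3) by (simp add: field_simps)
      then have "?r < e / 4 * (real n / ln (real n))" using elim(2) by linarith
      also have "\<dots> = e * (real n / (4 * ln (real n)))" by simp
      also have "\<dots> \<le> e * ?p" using pi e by (intro mult_left_mono) auto
      finally show ?thesis using p by (simp add: divide_less_eq)
    qed
    finally show ?case .
  qed
qed

theorem theorem2p7:
  fixes c :: real
  shows "((\<lambda>x :: real. real (psi_b c x) / real (prime_pi x)) \<longlongrightarrow> 1) at_top"
proof -
  have lim: "filterlim (\<lambda>x::real. nat \<lfloor>x\<rfloor>) sequentially at_top"
    by (rule filterlim_compose[OF filterlim_nat_sequentially filterlim_floor_sequentially])
  have "((\<lambda>x :: real. real (psi_b c (real (nat \<lfloor>x\<rfloor>))) / real (prime_pi (real (nat \<lfloor>x\<rfloor>)))) \<longlongrightarrow> 1) at_top"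
    by (rule filterlim_compose[OF psi_b_ratio_tendsto_sequentially lim])
  \<comment> \<open>Both counts depend only on the integer part of a nonnegative
    \<open>x\<close>.\<close>
  moreover have "eventually (\<lambda>x::real. real (psi_b c (real (nat \<lfloor>x\<rfloor>))) / real (prime_pi (real (nat \<lfloor>x\<rfloor>))) =
      real (psi_b c x) / real (prime_pi x)) at_top"
    using eventually_ge_at_top[of 0]
  proof eventually_elim
    case (elim x)
    have "q \<le> nat \<lfloor>x\<rfloor> \<longleftrightarrow> real q \<le> x" for q using elim by (simp add: le_nat_iff le_floor_iff)
    then show ?case by (simp add: psi_b_def prime_pi_def)
  qed
  ultimately show ?thesis by (rule Lim_transform_eventually)
qed

end
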